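(* For every integer $k\geq 42$ there is a constant $t_k$, depending only on $k$, with $$t_k=\frac{\sqrt{2}}{1-2\sin(\pi/8)}+O(k^{-1})\;(\approx 6.03+O(k^{-1}))\quad\text{as } k\to\infty,$$ such that for every finite point set $\mathcal{P}\subset\mathbb{R}^2$ the Yao-Yao graph $\mathsf{YY}_{2k}(\mathcal{P})$ is a geometric $t_k$-spanner.
   Context: Polar angles are measured from the positive $x$-axis, modulo $2\pi$. For a point $u$ and angles $\gamma_1<\gamma_2$, the cone $C_u(\gamma_1,\gamma_2)$ is the set of points $w\neq u$ such that the polar angle of the vector $\overrightarrow{uw}$ lies in $[\gamma_1,\gamma_2)$. Let $\mathcal{P}$ be a finite set of points in the plane and $m$ a positive integer. Yao graph $\mathsf{Y}_m(\mathcal{P})$: for each $u\in\mathcal{P}$ and each $j=0,\dots,m-1$, among the points $v\in\mathcal{P}\cap C_u(2j\pi/m,2(j+1)\pi/m)$ (if any) select one with $|uv|$ smallest and add the directed edge $\overrightarrow{uv}$. Ties are broken in an arbitrary but consistent manner. Yao-Yao graph $\mathsf{YY}_m(\mathcal{P})$: for each $u\in\mathcal{P}$ and each $j=0,\dots,m-1$, among the points $v\in\mathcal{P}\cap C_u(2j\pi/m,2(j+1)\pi/m)$ such that $\overrightarrow{vu}$ is an edge of $\mathsf{Y}_m(\mathcal{P})$ (if any), select one with $|uv|$ smallest and add the edge $\overrightarrow{vu}$ to $\mathsf{YY}_m(\mathcal{P})$. A graph $G$ with vertex set $\mathcal{P}$ (edges regarded as undirected, with Euclidean lengths) is a geometric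 $t$-spanner if for all $u,v\in\mathcal{P}$ the shortest $u$-$v$ path in $G$ has length at most $t|uv|$. *)

theory Defs
  imports "HOL-Analysis.Analysis" "HOL-Library.Landau_Symbols"
begin

definition polar_angle :: "complex \<Rightarrow> real" where
  "polar_angle z = (if Arg z < 0 then Arg z + 2 * pi else Arg z)"

definition cone :: "complex \<Rightarrow> real \<Rightarrow> real \<Rightarrow> complex set" where
  "cone u g1 g2 = {w. w \<noteq> u \<and> g1 \<le> polar_angle (w - u) \<and> polar_angle (w - u) < g2}"

definition yao_cone :: "nat \<Rightarrow> complex \<Rightarrow> nat \<Rightarrow> complex set" where
  "yao_cone m u j = cone u (2 * real j * pi / real m) (2 * real (Suc j) * pi / real m)"

text \<open>Consistent tie breaking: candidates v (seen from u) are compared by the key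
  (|uv|, rk v) lexicographically, where rk is an injective ranking of the points.\<close>

definition key_le :: "(complex \<Rightarrow> nat) \<Rightarrow> complex \<Rightarrow> complex \<Rightarrow> complex \<Rightarrow> bool" where
  "key_le rk u v w \<longleftrightarrow> cmod (v - u) < cmod (w - u) \<or> (cmod (v - u) = cmod (w - u) \<and> rk v \<le> rk w)"

definition yao_edge :: "nat \<Rightarrow> (complex \<Rightarrow> nat) \<Rightarrow> complex set \<Rightarrow> complex \<Rightarrow> complex \<Rightarrow> bool" where
  "yao_edge m rk P u v \<longleftrightarrow> u \<in> P \<and> (\<exists>j<m. v \<in> P \<inter> yao_cone m u j \<and>
      (\<forall>w \<in> P \<inter> yao_cone m u j. key_le rk u v w))"

definition yy_edge :: "nat \<Rightarrow> (complex \<Rightarrow> nat) \<Rightarrow> complex set \<Rightarrow> complex \<Rightarrow> complex \<Rightarrow> bool" where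
  "yy_edge m rk P v u \<longleftrightarrow> u \<in> P \<and> (\<exists>j<m. v \<in> P \<inter> yao_cone m u j \<and> yao_edge m rk P v u \<and>
      (\<forall>w \<in> P \<inter> yao_cone m u j. yao_edge m rk P w u \<longrightarrow> key_le rk u v w))"

fun is_walk :: "(complex \<Rightarrow> complex \<Rightarrow> bool) \<Rightarrow> complex list \<Rightarrow> bool" where
  "is_walk E (a # b # xs) = ((E a b \<or> E b a) \<and> is_walk E (b # xs))"
| "is_walk E _ = True"

fun walk_length :: "complex list \<Rightarrow> real" where
  "walk_length (a # b # xs) = cmod (b - a) + walk_length (b # xs)"
| "walk_length _ = 0"

definition geometric_spanner :: "complex set \<Rightarrow> (complex \<Rightarrow> complex \<Rightarrow> bool) \<Rightarrow> real \<Rightarrow> bool" where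
  "geometric_spanner P E t \<longleftrightarrow> (\<forall>u\<in>P. \<forall>v\<in>P. \<exists>xs. xs \<noteq> [] \<and> hd xs = u \<and> last xs = v \<and>
      set xs \<subseteq> P \<and> is_walk E xs \<and> walk_length xs \<le> t * cmod (v - u))"

end

theory Submission
  imports Defs
begin

text \<open>
  Induct on \<open>|uv|\<close>. A window of about \<open>k/2\<close> consecutive cones at \<open>u\<close>, of total opening at least \<open>\<pi>/2\<close>
  and centred on the direction of \<open>v\<close>, has a nearest point \<open>v0\<close>, at distance \<open>r\<close> say. Replacing \<open>u\<close> by
  \<open>v0\<close> shortens the distance to \<open>v\<close> by at least \<open>(1 - 2 sin (\<pi>/8 + O(1/k))) r\<close>, so it suffices to join
  \<open>u\<close> to \<open>v0\<close> by a path of length \<open>(1 + O(1/k)) r\<close>. The Yao edge from \<open>u\<close> to \<open>v0\<close> is either kept or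
  beaten at \<open>v0\<close> by an edge from some \<open>b\<close>, which must lie just outside the window. With the nearer side of
  the window as horizontal axis, \<open>b\<close> lies below it and no point above it is closer than \<open>r\<close>. Since nothing
  above the axis can interfere, \<open>b\<close> is joined to \<open>u\<close> by a chain of nearly horizontal Yao edges; each of them
  that was beaten is repaired recursively by a chain in the opposite direction, and the other steps are steep,
  so their cost, given by the induction hypothesis, is paid for by the vertical drop. The cost of the whole
  chain is at most \<open>x0\<close> times its horizontal extent plus \<open>y\<close> times its drop.

  The resulting stretch tends to \<open>1 / (1 - 2 sin (\<pi>/8))\<close>, hence is eventually below the claimed constant.
\<close>

section \<open>Planar inequalities for obstructing points\<close>

text \<open>The apex is the origin, the observer is \<open>(m, -g)\<close> and the obstructing point
  is \<open>(xa, xb)\<close>. Dropping \<open>xb * g\<close> from \<open>le\<close> leaves the disc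
  \<open>xa\<^sup>2 + xb\<^sup>2 \<le> 2 * m * xa\<close>, which settles \<open>xa < m / 2\<close>.
  Otherwise the slope bound makes \<open>xb\<close> at most \<open>6/5\<close> of
  \<open>m - xa\<close>, which is at most \<open>m / 2\<close>.\<close>

lemma shadow_same_side:
  fixes m g xa xb :: real
  assumes "0 < xa" "xa < m" "0 \<le> xb" "0 \<le> g" "xb + g \<le> 6/5 * (m - xa)"
    and le: "(m - xa)\<^sup>2 + (xb + g)\<^sup>2 \<le> m\<^sup>2 + g\<^sup>2"
  shows "xa\<^sup>2 + xb\<^sup>2 < m\<^sup>2"
proof -
  have gx: "0 \<le> xb * g" using assms by simp
  have "xa\<^sup>2 + xb\<^sup>2 \<le> 2 * m * xa"
    using le gx by (simp add: power2_eq_square algebra_simps)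
  show ?thesis
  proof (cases "xa < m / 2")
    case True
    then have "2 * m * xa < m * m" using assms by (simp add: field_simps)
    then show ?thesis using \<open>xa\<^sup>2 + xb\<^sup>2 \<le> 2 * m * xa\<close> by (simp add: power2_eq_square)
  next
    case False
    define d where "d = m - xa"
    have d: "0 < d" "d \<le> m / 2" "xb \<le> 6/5 * d" using False assms by (auto simp: d_def)
    have "xb\<^sup>2 \<le> (6/5 * d)\<^sup>2" using d assms by (intro power_mono) auto
    moreover have "d * (2 * m - 61/25 * d) > 0" using d assms by (intro mult_pos_pos) auto
    moreover have "xa\<^sup>2 = m\<^sup>2 - 2 * m * d + d\<^sup>2"
      by (simp add: d_def power2_eq_square algebra_simps)
    moreover have "(6/5 * d)\<^sup>2 = 36/25 * d\<^sup>2" by (simp add: power2_eq_square)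
    moreover have "d * (2 * m - 61/25 * d) = 2 * m * d - 61/25 * d\<^sup>2"
      by (simp add: power2_eq_square right_diff_distrib)
    ultimately show ?thesis by linarith
  qed
qed

text \<open>The old apex is the origin, the new one \<open>(L, -lam)\<close>, the observer
  \<open>(m, -g)\<close>, the obstructing point \<open>(xa, xb)\<close>. Being farther than
  \<open>L\<close> from the origin forces \<open>L - xa \<le> xb\<close>, so the possibly negative
  term \<open>2 * m * (L - xa)\<close> is at least \<open>- g * xb\<close> and is absorbed by
  \<open>2 * g * xb\<close>.\<close>

lemma shadow_opposite_side:
  fixes L X m g lam xa xb :: real
  assumes "0 < xa" "xa < L" "L < X" "X\<^sup>2 \<le> xa\<^sup>2 + xb\<^sup>2" "0 \<le> xb" "0 \<le> lam" "lam \<le> g"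
    and "- g / 2 \<le> m"
  shows "(L - m)\<^sup>2 + (g - lam)\<^sup>2 < (xa - m)\<^sup>2 + (xb + g)\<^sup>2"
proof -
  have LX: "L\<^sup>2 < X\<^sup>2" using assms by (intro power_strict_mono) auto
  have xb: "L - xa \<le> xb"
  proof (rule power2_le_imp_le)
    have "(L - xa)\<^sup>2 \<le> L\<^sup>2 - xa\<^sup>2"
      using assms mult_mono[of xa L xa xa] by (simp add: power2_eq_square algebra_simps)
    then show "(L - xa)\<^sup>2 \<le> xb\<^sup>2" using LX assms(4) by linarith
  qed fact
  have "0 \<le> 2 * m * (L - xa) + 2 * g * xb"
  proof -
    have "- g * (L - xa) \<le> 2 * m * (L - xa)"
      using assms by (intro mult_right_mono) auto
    moreover have "g * (L - xa) \<le> g * xb" using xb assms by (intro mult_left_mono) auto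
    moreover have "0 \<le> g * xb" using assms by simp
    ultimately show ?thesis by linarith
  qed
  moreover have "lam * lam \<le> g * lam" using assms by (intro mult_right_mono) auto
  moreover have "0 \<le> g * lam" using assms by simp
  ultimately show ?thesis using LX assms(4)
    by (simp add: power2_eq_square algebra_simps)
qed

text \<open>Lowering the viewpoint from the apex by \<open>g\<close> keeps a steep point steep, even
  when the viewpoint also moves up to \<open>g / 2\<close> away: \<open>6/5\<close> of
  \<open>g / 2\<close> is at most \<open>g\<close>.\<close>

lemma steep_not_visible:
  fixes m g xa xb :: real
  assumes "6/5 * xa < xb" "0 \<le> g" "- g / 2 \<le> m"
  shows "6/5 * (xa - m) < xb + g"
  using assms by simp

text \<open>The bounds on \<open>st\<close> and \<open>ct\<close> make the tangent of the cone angle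
  at most 1/12, so within a cone a slope of at most 1 grows to at most (1 + 1/12) / (1 - 1/12) =
  13/11 < 6/5. This is the origin of the threshold \<open>6/5\<close>.\<close>

lemma slope_in_class:
  fixes zr zi wr wi ct st n :: real
  assumes "0 < wr" "0 \<le> wi" "wi \<le> wr" "0 \<le> zi" "0 < n" "0 < st" "st \<le> 2/25" "24/25 \<le> ct"
    and dot: "ct * n \<le> zr * wr + zi * wi" and cross: "zi * wr - zr * wi \<le> st * n"
  shows "0 < zr \<and> zi \<le> 6/5 * zr"
proof -
  have "0 < ct * n" using assms by simp
  then have d0: "0 < zr * wr + zi * wi" using dot by linarith
  have "12 * (st * n) \<le> ct * n" using assms mult_right_mono[of "12 * st" ct n] by simp
  then have "12 * (zi * wr - zr * wi) \<le> zr * wr + zi * wi"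
    using mult_left_mono[OF cross, of 12] dot by linarith
  then have e: "zi * (12 * wr - wi) \<le> zr * (12 * wi + wr)" by (simp add: algebra_simps)
  have pos: "0 < 12 * wr - wi" "0 < 12 * wi + wr" using assms by auto
  have zr: "0 < zr"
  proof (rule ccontr)
    assume n: "\<not> 0 < zr"
    then have "zr * (12 * wi + wr) \<le> 0" using pos by (simp add: mult_le_0_iff)
    then have "zi * (12 * wr - wi) \<le> 0" using e by linarith
    then have "zi = 0" using pos assms by (simp add: mult_le_0_iff)
    moreover have "zr * wr \<le> 0" using n assms by (simp add: mult_le_0_iff)
    ultimately show False using d0 by simp
  qed
  have "zi * (11 * wr) \<le> zi * (12 * wr - wi)" using assms by (intro mult_left_mono) auto
  moreover have "zr * (12 * wi + wr) \<le> zr * (13 * wr)" using zr assms by (intro mult_left_mono) auto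
  ultimately have "(11 * zi) * wr \<le> (13 * zr) * wr" using e by (simp add: algebra_simps)
  then have "11 * zi \<le> 13 * zr" using assms by simp
  then show ?thesis using zr by simp
qed

section \<open>Inequalities for the cost of detours\<close>

text \<open>For a Yao edge \<open>(L, H)\<close> beaten by an edge \<open>(zr, zi)\<close> of length
  \<open>z\<close> in the same cone: the beating edge plus a reversed chain of cost
  \<open>x0 * (L - zr) + y * (zi - H)\<close> costs at most \<open>x0 * L + y * H\<close>. The
  vector \<open>(zr, zi)\<close> is resolved along and across \<open>(L, H)\<close> into
  \<open>D\<close> and \<open>E\<close>.\<close>

lemma spike_cost:
  fixes L H zr zi z n ct st x0 y :: real
  assumes "0 \<le> L" "0 \<le> H" "n\<^sup>2 = L\<^sup>2 + H\<^sup>2" "0 < n" "z\<^sup>2 = zr\<^sup>2 + zi\<^sup>2" "0 \<le> z" "z \<le> n"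
    and dot: "ct * (z * n) \<le> zr * L + zi * H" and cross: "zi * L - zr * H \<le> st * (z * n)"
    and "0 \<le> y" "0 \<le> x0" "x0 * ct = 1 + y * st" "1 \<le> y - x0 * st"
  shows "z + y * zi \<le> x0 * zr + 2 * y * H"
proof -
  define D E where "D = zr * L + zi * H" and "E = zi * L - zr * H"
  have zrn: "zr * n\<^sup>2 = D * L - E * H" and zin: "zi * n\<^sup>2 = D * H + E * L"
    unfolding assms(3) D_def E_def by (simp_all add: power2_eq_square algebra_simps)
  have "D\<^sup>2 + E\<^sup>2 = (z * n)\<^sup>2"
    unfolding power_mult_distrib assms(3,5) D_def E_def by (simp add: power2_eq_square algebra_simps)
  then have "D\<^sup>2 \<le> (z * n)\<^sup>2" using zero_le_power2[of E] by linarith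
  then have Dz: "D \<le> z * n" by (rule power2_le_imp_le) (use assms in simp)
  have nLH: "n \<le> L + H"
  proof (rule power2_le_imp_le)
    show "n\<^sup>2 \<le> (L + H)\<^sup>2" using assms by (simp add: power2_eq_square algebra_simps)
  qed (use assms in simp)
  have 1: "x0 * L * (ct * (z * n)) \<le> x0 * L * D"
    using dot assms by (intro mult_left_mono) (auto simp: D_def)
  have 2: "y * H * D \<le> y * H * (z * n)" using Dz assms by (intro mult_left_mono) auto
  have 3: "(x0 * H + y * L) * E \<le> (x0 * H + y * L) * (st * (z * n))"
    using cross assms by (intro mult_left_mono) (auto simp: E_def)
  have 4: "(2 * y * H) * (z * n) \<le> (2 * y * H) * (n * n)"
    using assms by (intro mult_left_mono mult_right_mono) auto
  \<comment> \<open>The equation for \<open>x0\<close> makes the coefficient of \<open>L\<close>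
    equal to 1, that of \<open>H\<close> is at least 1, and \<open>n \<le> L + H\<close>.\<close>
  have 5: "0 \<le> (z * n) * (L * (x0 * ct - y * st) + H * (y - x0 * st) - n)"
  proof (intro mult_nonneg_nonneg)
    have "H \<le> H * (y - x0 * st)" using assms mult_left_mono[of 1 "y - x0 * st" H] by simp
    then show "0 \<le> L * (x0 * ct - y * st) + H * (y - x0 * st) - n" using nLH assms by simp
  qed (use assms in auto)
  have "0 \<le> x0 * (D * L - E * H) - y * (D * H + E * L) + 2 * y * H * n\<^sup>2 - z * n\<^sup>2"
    using 1 2 3 4 5 by (simp add: power2_eq_square algebra_simps)
  then have "0 \<le> (x0 * zr + 2 * y * H - (z + y * zi)) * n\<^sup>2"
    unfolding zrn[symmetric] zin[symmetric] by (simp add: algebra_simps)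
  then show ?thesis using assms(4) by (simp add: zero_le_mult_iff)
qed

text \<open>The beating edge starts past the far end of \<open>(L, H)\<close>, and the gap
  \<open>d\<close> is bridged directly. The cone condition gives
  \<open>H - zi \<le> st * (L + H)\<close>, and \<open>zr \<le> z \<le> n \<le> L + H\<close>; hence
  \<open>d\<close> is at most \<open>H + st * (L + H)\<close>, which is mostly charged to the
  drop.\<close>

lemma beyond_cost:
  fixes L H zr zi z n d st t x0 y :: real
  assumes "0 < L" "0 \<le> H" "H \<le> L" "n\<^sup>2 = L\<^sup>2 + H\<^sup>2" "0 \<le> n" "z\<^sup>2 = zr\<^sup>2 + zi\<^sup>2" "0 \<le> z" "z \<le> n"
    and cross: "- (st * (z * n)) \<le> zi * L - zr * H"
    and "L \<le> zr" "zi \<le> H" "d \<le> (zr - L) + (H - zi)"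
    and "0 < st" "0 \<le> t" "1 + t * st \<le> x0" "1 + t + t * st \<le> y"
  shows "z + t * d \<le> x0 * L + y * H"
proof -
  have nLH: "n \<le> L + H"
  proof (rule power2_le_imp_le)
    show "n\<^sup>2 \<le> (L + H)\<^sup>2" using assms by (simp add: power2_eq_square algebra_simps)
  qed (use assms in simp)
  have "zr\<^sup>2 \<le> z\<^sup>2" using assms(6) by simp
  then have "zr \<le> z" by (rule power2_le_imp_le) fact
  have "z * n \<le> n * n" using assms by (intro mult_right_mono) auto
  also have "\<dots> = L\<^sup>2 + H\<^sup>2" using assms by (simp add: power2_eq_square)
  also have "\<dots> \<le> (L + H) * L"
    using mult_left_mono[of H L H] assms by (simp add: power2_eq_square algebra_simps)
  finally have "st * (z * n) \<le> st * ((L + H) * L)" using assms by simp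
  moreover have "L * H \<le> zr * H" using assms by (intro mult_right_mono) auto
  ultimately have "(H - zi) * L \<le> (st * (L + H)) * L"
    using cross by (simp add: algebra_simps)
  then have "H - zi \<le> st * (L + H)" using assms by simp
  then have "d \<le> H + st * (L + H)" using assms nLH \<open>zr \<le> z\<close> by linarith
  then have "t * d \<le> t * (H + st * (L + H))" using assms by (intro mult_left_mono) auto
  moreover have "z \<le> L + H" using nLH assms by linarith
  moreover have "(1 + t * st) * L \<le> x0 * L" "(1 + t + t * st) * H \<le> y * H"
    using assms by (auto intro: mult_right_mono)
  ultimately show ?thesis by (simp add: algebra_simps)
qed

text \<open>In the difference of squares
  \<open>(L' - L) * (L' + L) \<le> (lam - H) * (lam + H)\<close> the second factors are at least and
  at most \<open>2 * L\<close>. Thus the excess width of an edge passing the apex is bounded by the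
  remaining drop.\<close>

lemma overshoot_cost:
  fixes L L' lam H :: real
  assumes "0 < L" "L \<le> L'" "0 \<le> lam" "lam \<le> L" "0 \<le> H" "H \<le> lam" "L'\<^sup>2 + H\<^sup>2 \<le> L\<^sup>2 + lam\<^sup>2"
  shows "L' - L \<le> lam - H"
proof -
  have "(L' - L) * (2 * L) \<le> (L' - L) * (L' + L)" using assms by (intro mult_left_mono) auto
  also have "\<dots> \<le> (lam - H) * (lam + H)" using assms by (simp add: power2_eq_square algebra_simps)
  also have "\<dots> \<le> (lam - H) * (2 * L)" using assms by (intro mult_left_mono) auto
  finally show ?thesis using assms by simp
qed

text \<open>The same resolution into \<open>D\<close> and \<open>E\<close>, for the first edge
  \<open>(A, B)\<close> of a window and the edge \<open>(zr, zi)\<close> beating it. The term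
  \<open>x0 * st * (z * B)\<close> is lost here and produces the factor
  \<open>1 + st\<close>.\<close>

lemma edge_cost:
  fixes A B r zr zi z ct st x0 y :: real
  assumes "0 \<le> A" "0 \<le> B" "r\<^sup>2 = A\<^sup>2 + B\<^sup>2" "0 < r" "z\<^sup>2 = zr\<^sup>2 + zi\<^sup>2" "0 \<le> z" "z \<le> r"
    and dot: "ct * (z * r) \<le> zr * A + zi * B" and cross: "\<bar>zi * A - zr * B\<bar> \<le> st * (z * r)"
    and "0 \<le> y" "1 \<le> x0" "x0 * ct = 1 + y * st" "0 < st"
  shows "z + x0 * (A - zr) + y * (zi - B) \<le> x0 * (1 + st) * r"
proof -
  define D E where "D = zr * A + zi * B" and "E = zi * A - zr * B"
  have zrn: "zr * r\<^sup>2 = D * A - E * B" and zin: "zi * r\<^sup>2 = D * B + E * A"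
    unfolding assms(3) D_def E_def by (simp_all add: power2_eq_square algebra_simps)
  have "D\<^sup>2 + E\<^sup>2 = (z * r)\<^sup>2"
    unfolding power_mult_distrib assms(3,5) D_def E_def by (simp add: power2_eq_square algebra_simps)
  then have "D\<^sup>2 \<le> (z * r)\<^sup>2" using zero_le_power2[of E] by linarith
  then have Dz: "D \<le> z * r" by (rule power2_le_imp_le) (use assms in simp)
  have Ar: "A \<le> r" by (rule power2_le_imp_le) (use assms in auto)
  have Br: "B \<le> r" by (rule power2_le_imp_le) (use assms in auto)
  have E: "E \<le> st * (z * r)" using cross by (simp add: E_def)
  have 1: "x0 * A * (ct * (z * r)) \<le> x0 * A * D"
    using dot assms by (intro mult_left_mono) (auto simp: D_def)
  have "z * r \<le> r * r" using assms by (intro mult_right_mono) auto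
  then have "D \<le> r * r" using Dz by linarith
  then have 2: "y * B * D \<le> y * B * (r * r)" using assms by (intro mult_left_mono) auto
  have 3: "(x0 * B + y * A) * E \<le> (x0 * B + y * A) * (st * (z * r))"
    using E assms by (intro mult_left_mono) auto
  have 4: "z * (r - A) \<le> x0 * (r * (r - A))"
  proof -
    have "z * (r - A) \<le> r * (r - A)" using assms Ar by (intro mult_right_mono) auto
    also have "\<dots> \<le> x0 * (r * (r - A))"
      using assms Ar mult_right_mono[of 1 x0 "r * (r - A)"] by simp
    finally show ?thesis .
  qed
  have 5: "x0 * st * (z * B) \<le> x0 * st * (r * r)"
    using assms Br by (intro mult_left_mono mult_mono) auto
  have 6: "x0 * ct * (A * (z * r)) = (1 + y * st) * (A * (z * r))" using assms by simp
  have 7: "r * (z * (r - A) + x0 * st * (z * B)) \<le> r * (x0 * (r * (r - A)) + x0 * st * (r * r))"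
    using assms by (intro mult_left_mono add_mono 4 5) simp
  have "(z + x0 * (A - zr) + y * (zi - B)) * r\<^sup>2
      = z * r\<^sup>2 + x0 * (A * r\<^sup>2 - (D * A - E * B)) + y * ((D * B + E * A) - B * r\<^sup>2)"
    unfolding zrn[symmetric] zin[symmetric] by (simp add: algebra_simps)
  also have "\<dots> \<le> x0 * (1 + st) * r * r\<^sup>2"
    using 1 2 3 6 7 by (simp add: power2_eq_square algebra_simps)
  finally show ?thesis using assms(4) by simp
qed

text \<open>The sign \<open>sg\<close> lets one argument serve chains running to the right and to
  the left; lengths do not depend on it.\<close>

lemma cmod_sg:
  assumes "sg = 1 \<or> sg = (-1::real)"
  shows "(cmod z)\<^sup>2 = (sg * Re z)\<^sup>2 + (Im z)\<^sup>2"
  using assms by (auto simp: cmod_power2)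

lemma sg_swap: "(sg * Re (a - b))\<^sup>2 = (sg * Re (b - a))\<^sup>2" for sg :: real
  by (simp add: power2_eq_square algebra_simps)

lemma ex_key_min:
  assumes "finite A" "A \<noteq> {}"
  shows "\<exists>c\<in>A. \<forall>x\<in>A. key_le rk a c x"
  using assms
proof (induction rule: finite_ne_induct)
  case (singleton x) then show ?case by (simp add: key_le_def)
next
  case (insert x F)
  then obtain c where c: "c \<in> F" "\<forall>z\<in>F. key_le rk a c z" by blast
  show ?case
  proof (cases "key_le rk a c x")
    case True then show ?thesis using c by blast
  next
    case False
    then have "key_le rk a x c" by (auto simp: key_le_def)
    then have "\<forall>z\<in>F. key_le rk a x z" using c(2) by (fastforce simp: key_le_def)
    then show ?thesis by (auto simp: key_le_def)
  qed
qed

text \<open>By the law of cosines, since twice 24/25 exceeds 1. It shows that an edge beating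
  another one at a common endpoint starts closer to the other's start than that edge is long, so
  that recursion descends.\<close>

lemma cmod_diff_less:
  assumes "z \<noteq> 0" "cmod z \<le> cmod w" "24/25 * (cmod z * cmod w) \<le> Re z * Re w + Im z * Im w"
  shows "cmod (w - z) < cmod w"
proof -
  have "(cmod (w - z))\<^sup>2 = (cmod w)\<^sup>2 + (cmod z)\<^sup>2 - 2 * (Re z * Re w + Im z * Im w)"
    unfolding cmod_power2 by (simp add: power2_eq_square algebra_simps)
  also have "\<dots> \<le> (cmod w)\<^sup>2 + (cmod z)\<^sup>2 - 2 * (24/25 * (cmod z * cmod w))"
    using assms(3) by simp
  also have "\<dots> < (cmod w)\<^sup>2"
  proof -
    have "cmod z * cmod z \<le> cmod z * cmod w" "0 < cmod z * cmod z"
      using assms by (auto intro: mult_left_mono)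
    then show ?thesis by (simp add: power2_eq_square)
  qed
  finally show ?thesis by (rule power2_less_imp_less) simp
qed

text \<open>\<open>C z w\<close> says that the vectors \<open>z\<close> and \<open>w\<close> point into the same cone, \<open>conn a b s\<close> that there is a
  path of length at most \<open>s\<close> from \<open>a\<close> to \<open>b\<close>; \<open>ct\<close> and \<open>st\<close> are the cosine and sine of the cone angle.\<close>

locale yao_frame =
  fixes P :: "complex set" and C :: "complex \<Rightarrow> complex \<Rightarrow> bool" and rk :: "complex \<Rightarrow> nat"
    and conn :: "complex \<Rightarrow> complex \<Rightarrow> real \<Rightarrow> bool" and ct st t r x0 y :: real
  assumes finite_P: "finite P"
    and C_sym: "C z w \<Longrightarrow> C w z"
    and C_trans: "C z w \<Longrightarrow> C w v \<Longrightarrow> C z v"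
    and C_refl: "z \<noteq> 0 \<Longrightarrow> C z z"
    and C_nz: "C z w \<Longrightarrow> z \<noteq> 0"
    and C_neg: "C z w \<Longrightarrow> C (- z) (- w)"
    and C_dot: "C z w \<Longrightarrow> ct * (cmod z * cmod w) \<le> Re z * Re w + Im z * Im w"
    and C_cross: "C z w \<Longrightarrow> \<bar>Im z * Re w - Re z * Im w\<bar> \<le> st * (cmod z * cmod w)"
    and C_Im: "C z w \<Longrightarrow> 0 \<le> Im z * Im w"
    and conn_sym: "conn a b s \<Longrightarrow> conn b a s"
    and conn_trans: "conn a b s \<Longrightarrow> conn b c s' \<Longrightarrow> conn a c (s + s')"
    and conn_mono: "conn a b s \<Longrightarrow> s \<le> s' \<Longrightarrow> conn a b s'"
    and short: "p \<in> P \<Longrightarrow> q \<in> P \<Longrightarrow> cmod (p - q) < r \<Longrightarrow> conn p q (t * cmod (p - q))"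
    and select: "a \<in> P \<Longrightarrow> c \<in> P \<Longrightarrow> c \<noteq> a \<Longrightarrow>
        (\<And>x. x \<in> P \<Longrightarrow> C (c - a) (x - a) \<Longrightarrow> key_le rk a c x) \<Longrightarrow>
        conn a c (cmod (c - a)) \<or>
        (\<exists>b\<in>P. b \<noteq> a \<and> C (b - c) (a - c) \<and> cmod (b - c) \<le> cmod (a - c) \<and> conn b c (cmod (b - c)))"
    and st: "0 < st" "st \<le> 2/25"
    and ct: "24/25 \<le> ct" "ct \<le> 1"
    and t: "1 \<le> t"
    and y: "y = sqrt 2 * t + x0"
    and x0: "x0 * ct = 1 + y * st" "1 \<le> x0"
    and yx: "1 \<le> y - x0 * st"
begin

section \<open>Half-planes made of whole cones\<close>

text \<open>The upper half-plane as a union of cones: a vector on the horizontal axis is assigned to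
  the side on which its cone lies, which makes \<open>up\<close> invariant under \<open>C\<close>.
  The zero vector is \<open>up\<close> vacuously.\<close>

definition up :: "complex \<Rightarrow> bool" where
  "up z \<longleftrightarrow> (\<forall>w. C z w \<longrightarrow> 0 \<le> Im w)"

lemma up_Im: "up z \<Longrightarrow> 0 \<le> Im z"
  using C_refl[of z] by (cases "z = 0") (auto simp: up_def)

lemma upI: "0 < Im z \<Longrightarrow> up z"
  unfolding up_def using C_Im[of z] by (meson not_less zero_le_mult_iff)

lemma up_C: "up z \<Longrightarrow> C z w \<Longrightarrow> up w"
  using C_trans by (auto simp: up_def)

lemma up_total: "\<not> up z \<Longrightarrow> up (- z)"
proof -
  assume "\<not> up z"
  then obtain w where w: "C z w" "Im w < 0" by (auto simp: up_def not_le)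
  show "up (- z)"
    unfolding up_def
  proof (intro allI impI)
    fix v assume "C (- z) v"
    then have "C z (- v)" using C_neg by fastforce
    then have "C w (- v)" using w C_sym C_trans by blast
    from C_Im[OF this] have "Im w * Im v \<le> 0" by simp
    with w show "0 \<le> Im v" by (simp add: mult_le_0_iff)
  qed
qed

lemma above_up:
  assumes "\<not> up (q - x)" shows "up (x - q)" "Im q \<le> Im x"
  using up_total[OF assms] up_Im[of "x - q"] by auto

text \<open>Points above \<open>q\<close> are those \<open>x\<close> with \<open>\<not> up (q - x)\<close>. The exceptional (steep) points of
  the first clause are never closer than \<open>q\<close> as seen from the points below \<open>q\<close> that matter.\<close>

definition shadow :: "complex \<Rightarrow> real \<Rightarrow> real \<Rightarrow> bool" where
  "shadow q X sg \<longleftrightarrow>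
    (\<forall>x\<in>P. x \<noteq> q \<and> \<not> up (q - x) \<and> 0 < sg * Re (x - q) \<longrightarrow>
        X \<le> cmod (x - q) \<or> 6/5 * (sg * Re (x - q)) < Im (x - q)) \<and>
    (\<forall>l\<in>P. \<forall>x\<in>P. up (q - l) \<and> sg * Re (l - q) < X \<and> x \<noteq> q \<and> \<not> up (q - x) \<and>
        0 < sg * Re (x - q) \<and> sg * Re (x - q) < sg * Re (l - q) \<and>
        Im (x - l) \<le> 6/5 * (sg * Re (l - x)) \<longrightarrow> cmod (q - l) < cmod (x - l))"

section \<open>Shadows and their transfer to a reversed chain\<close>

text \<open>For points at distance at least \<open>X\<close> the second clause of
  \<open>shadow\<close> is automatic: by \<open>shadow_same_side\<close>, a point no farther from
  \<open>l\<close> than \<open>q\<close> would be closer to \<open>q\<close> than the horizontal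
  offset of \<open>l\<close>, which is below \<open>X\<close>.\<close>

lemma shadow_visible:
  assumes sg: "sg = 1 \<or> sg = -1" and "up (q - l)" "\<not> up (q - x)"
    and X: "sg * Re (l - q) < X" "X \<le> cmod (x - q)"
    and "0 < sg * Re (x - q)" "sg * Re (x - q) < sg * Re (l - q)"
    and "Im (x - l) \<le> 6/5 * (sg * Re (l - x))"
  shows "cmod (q - l) < cmod (x - l)"
proof (rule ccontr)
  assume "\<not> ?thesis"
  then have "(cmod (x - l))\<^sup>2 \<le> (cmod (q - l))\<^sup>2" by (intro power_mono) auto
  then have le: "(sg * Re (x - l))\<^sup>2 + (Im (x - l))\<^sup>2 \<le> (sg * Re (q - l))\<^sup>2 + (Im (q - l))\<^sup>2"
    by (simp add: cmod_sg[OF sg])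
  define m g xa xb where "m = sg * Re (l - q)" and "g = Im (q - l)"
    and "xa = sg * Re (x - q)" and "xb = Im (x - q)"
  have "xa\<^sup>2 + xb\<^sup>2 < m\<^sup>2"
  proof (rule shadow_same_side)
    show "0 \<le> xb" using above_up[OF assms(3)] by (simp add: xb_def)
    show "0 \<le> g" using up_Im[OF assms(2)] by (simp add: g_def)
    have "m - xa = - (sg * Re (x - l))" "xb + g = Im (x - l)" "m = - (sg * Re (q - l))" "g = Im (q - l)"
      by (simp_all add: m_def g_def xa_def xb_def algebra_simps)
    then show "(m - xa)\<^sup>2 + (xb + g)\<^sup>2 \<le> m\<^sup>2 + g\<^sup>2"
      using le by (simp only: power2_minus)
    show "xb + g \<le> 6/5 * (m - xa)"
      using assms(8) unfolding m_def g_def xa_def xb_def by (simp add: algebra_simps)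
  qed (use assms in \<open>auto simp: xa_def m_def\<close>)
  then have "(cmod (x - q))\<^sup>2 < m\<^sup>2" by (simp add: cmod_sg[OF sg] xa_def xb_def)
  moreover have "0 \<le> m" using assms by (simp add: m_def)
  ultimately have "cmod (x - q) < m" by (rule power2_less_imp_less)
  then show False using X by (simp add: m_def)
qed

text \<open>The possible next vertices of the chain from \<open>a\<close> back to the apex
  \<open>q\<close>. They range over a whole quadrant at \<open>a\<close> below the level of
  \<open>q\<close>, not over a single cone.\<close>

definition cand :: "complex \<Rightarrow> complex \<Rightarrow> real \<Rightarrow> complex set" where
  "cand q a sg = {x\<in>P. x \<noteq> a \<and> up (x - a) \<and> 0 < sg * Re (a - x) \<and> (x = q \<or> up (q - x)) \<and>
     cmod (x - a) \<le> cmod (q - a)}"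

text \<open>Such an \<open>x\<close> can fail to be a candidate only by lying above
  \<open>q\<close>. Being at least as high as \<open>q\<close> and no farther from \<open>a\<close>,
  it is horizontally nearer to \<open>a\<close>; equality would force \<open>x = q\<close>.\<close>

lemma not_cand:
  assumes sg: "sg = 1 \<or> sg = -1" and "0 < sg * Re (a - q)" and "up (q - a)"
    and x: "x \<in> P" "x \<noteq> a" "up (x - a)" "0 < sg * Re (a - x)" "cmod (x - a) \<le> cmod (q - a)"
    and nc: "x \<notin> cand q a sg"
  shows "x \<noteq> q" "\<not> up (q - x)" "0 < sg * Re (x - q)" "sg * Re (x - q) < sg * Re (a - q)"
proof -
  show xq: "x \<noteq> q" and nu: "\<not> up (q - x)" using x nc by (auto simp: cand_def)
  have i: "Im q \<le> Im x" using above_up(2)[OF nu] .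
  have aq: "Im a \<le> Im q" using up_Im[OF assms(3)] by simp
  have "(cmod (x - a))\<^sup>2 \<le> (cmod (q - a))\<^sup>2" using x by (intro power_mono) auto
  then have le: "(sg * Re (x - a))\<^sup>2 + (Im (x - a))\<^sup>2 \<le> (sg * Re (q - a))\<^sup>2 + (Im (q - a))\<^sup>2"
    by (simp add: cmod_sg[OF sg])
  have im: "(Im (q - a))\<^sup>2 \<le> (Im (x - a))\<^sup>2" using i aq by (intro power_mono) auto
  have "(sg * Re (a - x))\<^sup>2 \<le> (sg * Re (a - q))\<^sup>2"
    using le im unfolding sg_swap[of sg a x] sg_swap[of sg a q] by linarith
  then have le2: "sg * Re (a - x) \<le> sg * Re (a - q)"
    by (rule power2_le_imp_le) (use assms(2) in linarith)
  have "sg * Re (a - x) \<noteq> sg * Re (a - q)"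
  proof
    assume e: "sg * Re (a - x) = sg * Re (a - q)"
    have "sg \<noteq> 0" using sg by linarith
    with e have re: "Re x = Re q" by simp
    then have "(Im (x - a))\<^sup>2 \<le> (Im (q - a))\<^sup>2" using le by simp
    then have "Im (x - a) \<le> Im (q - a)" by (rule power2_le_imp_le) (use aq in simp)
    then have "Im x = Im q" using i by simp
    with re xq show False by (simp add: complex_eq_iff)
  qed
  with le2 have "sg * Re (a - x) < sg * Re (a - q)" by linarith
  then show "0 < sg * Re (x - q)" by (simp add: right_diff_distrib)
  show "sg * Re (x - q) < sg * Re (a - q)" using x by (simp add: algebra_simps)
qed

text \<open>A point above \<open>a\<close> and closer than the nearest candidate \<open>c\<close> is
  no candidate, hence lies above \<open>q\<close> and between \<open>q\<close> and \<open>a\<close>;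
  the shadow of \<open>q\<close> then makes it steep as seen from \<open>a\<close>. If it is visible
  from some \<open>l\<close> below \<open>a\<close>, it is not steep at \<open>q\<close>, hence at
  distance at least \<open>X\<close> from \<open>q\<close>, and \<open>shadow_opposite_side\<close>
  applies. The remaining points fall under \<open>shadow_visible\<close>.\<close>

lemma shadow_child:
  assumes sg: "sg = 1 \<or> sg = -1" and S: "shadow q X sg" and P: "q \<in> P" "a \<in> P"
    and qa: "up (q - a)" "0 < sg * Re (a - q)" "sg * Re (a - q) < X"
    and flat: "Im (q - a) \<le> sg * Re (a - q)"
    and c: "c \<in> cand q a sg" "\<And>x. x \<in> cand q a sg \<Longrightarrow> cmod (c - a) \<le> cmod (x - a)"
  shows "shadow a (sg * Re (a - c)) (- sg)"
proof -
  have msg: "- sg = 1 \<or> - sg = -1" using sg by auto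
  define L lam where "L = sg * Re (a - q)" and "lam = Im (q - a)"
  define L' where "L' = sg * Re (a - c)"
  have lam: "0 \<le> lam" "lam \<le> L" "0 < L" using up_Im[OF qa(1)] flat qa by (auto simp: lam_def L_def)
  have ca: "cmod (c - a) \<le> cmod (q - a)" and cup: "up (c - a)" and L'0: "0 < L'"
    using c(1) by (auto simp: cand_def L'_def)
  have L'le: "L' \<le> cmod (c - a)"
  proof (rule power2_le_imp_le)
    show "L'\<^sup>2 \<le> (cmod (c - a))\<^sup>2"
      unfolding cmod_sg[OF sg] L'_def sg_swap[of sg a c] by simp
  qed simp
  \<comment> \<open>The candidate \<open>c\<close> may lie past \<open>q\<close>, but it stays in
    the disc about \<open>a\<close> through \<open>q\<close>. This yields the bound
    \<open>- g / 2 \<le> m\<close> below.\<close>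
  have over: "L' - L \<le> lam / 2"
  proof (cases "L' \<le> L")
    case True then show ?thesis using lam by simp
  next
    case False
    have "(cmod (c - a))\<^sup>2 \<le> (cmod (q - a))\<^sup>2" using ca by (intro power_mono) auto
    then have "L'\<^sup>2 \<le> L\<^sup>2 + lam\<^sup>2"
      using zero_le_power2[of "Im (c - a)"]
      unfolding cmod_sg[OF sg] L'_def L_def lam_def sg_swap[of sg a c] sg_swap[of sg a q] by linarith
    then have "(L' - L) * (L' + L) \<le> lam * lam" by (simp add: power2_eq_square algebra_simps)
    moreover have "(L' - L) * (2 * L) \<le> (L' - L) * (L' + L)" using False by (intro mult_left_mono) auto
    moreover have "lam * lam \<le> lam * L" using lam by (intro mult_left_mono) auto
    ultimately have "(L' - L) * 2 * L \<le> lam * L" by (simp only: mult.assoc)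
    then show ?thesis using lam by simp
  qed
  have exc: "x \<noteq> q \<and> \<not> up (q - x) \<and> 0 < sg * Re (x - q) \<and> sg * Re (x - q) < L"
    "6/5 * (sg * Re (a - x)) < Im (x - a)"
    if x: "x \<in> P" "x \<noteq> a" "\<not> up (a - x)" "0 < sg * Re (a - x)" "cmod (x - a) < L'" for x
  proof -
    have nc: "x \<notin> cand q a sg" using c(2)[of x] x(5) L'le by fastforce
    have xup: "up (x - a)" using above_up[OF x(3)] by simp
    have lt: "cmod (x - a) \<le> cmod (q - a)" using x L'le ca by simp
    note n = not_cand[OF sg qa(2) qa(1) x(1,2) xup x(4) lt nc]
    then show "x \<noteq> q \<and> \<not> up (q - x) \<and> 0 < sg * Re (x - q) \<and> sg * Re (x - q) < L"
      by (auto simp: L_def)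
    show "6/5 * (sg * Re (a - x)) < Im (x - a)"
    proof (rule ccontr)
      assume "\<not> ?thesis"
      \<comment> \<open>The second clause of the shadow of \<open>q\<close>, at
        \<open>l = a\<close>.\<close>
      then have "cmod (q - a) < cmod (x - a)"
        using S P x(1) qa n unfolding shadow_def by (auto simp: not_less)
      then show False using lt by simp
    qed
  qed
  show ?thesis
    unfolding shadow_def L'_def[symmetric]
  proof (intro conjI ballI impI)
    fix x assume x: "x \<in> P" and h: "x \<noteq> a \<and> \<not> up (a - x) \<and> 0 < - sg * Re (x - a)"
    then have "0 < sg * Re (a - x)" by (simp add: algebra_simps)
    then show "L' \<le> cmod (x - a) \<or> 6/5 * (- sg * Re (x - a)) < Im (x - a)"
      using exc(2)[of x] x h by (cases "cmod (x - a) < L'") (auto simp: right_diff_distrib)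
  next
    fix l x assume l: "l \<in> P" and x: "x \<in> P"
      and h: "up (a - l) \<and> - sg * Re (l - a) < L' \<and> x \<noteq> a \<and> \<not> up (a - x) \<and>
        0 < - sg * Re (x - a) \<and> - sg * Re (x - a) < - sg * Re (l - a) \<and>
        Im (x - l) \<le> 6/5 * (- sg * Re (l - x))"
    show "cmod (a - l) < cmod (x - l)"
    proof (cases "L' \<le> cmod (x - a)")
      case True
      then show ?thesis using shadow_visible[OF msg, of a l x L'] h by blast
    next
      case False
      have sx: "0 < sg * Re (a - x)" using h by (simp add: algebra_simps)
      note e = exc[of x, OF x _ _ sx] 
      have e1: "x \<noteq> q" "\<not> up (q - x)" "0 < sg * Re (x - q)" "sg * Re (x - q) < L"
        using e(1) h False by (auto simp: not_le)
      define m g xa xb where "m = sg * Re (l - q)" and "g = Im (q - l)"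
        and "xa = sg * Re (x - q)" and "xb = Im (x - q)"
      have g: "lam \<le> g" using up_Im[of "a - l"] h by (simp add: g_def lam_def)
      have "L - L' < m" using h by (simp add: m_def L_def algebra_simps)
      then have m: "- g / 2 \<le> m" using over g by simp
      have xb: "0 \<le> xb" using above_up[OF e1(2)] by (simp add: xb_def)
      have vis: "xb + g \<le> 6/5 * (xa - m)"
        using h by (simp add: xb_def g_def xa_def m_def algebra_simps)
      have ns: "\<not> 6/5 * (sg * Re (x - q)) < Im (x - q)"
        using steep_not_visible[of xa xb g m] vis g lam m by (auto simp: xa_def xb_def)
      then have X: "X \<le> cmod (x - q)"
        using S x e1 unfolding shadow_def by blast
      then have "X\<^sup>2 \<le> (cmod (x - q))\<^sup>2" using qa by (intro power_mono) auto
      then have X2: "X\<^sup>2 \<le> xa\<^sup>2 + xb\<^sup>2" by (simp add: cmod_sg[OF sg] xa_def xb_def)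
      have "(L - m)\<^sup>2 + (g - lam)\<^sup>2 < (xa - m)\<^sup>2 + (xb + g)\<^sup>2"
        using e1 qa X2 xb lam g m by (intro shadow_opposite_side[of xa L X]) (auto simp: xa_def L_def)
      moreover have "L - m = sg * Re (a - l)" "g - lam = Im (a - l)" "xa - m = sg * Re (x - l)"
        "xb + g = Im (x - l)"
        by (simp_all add: L_def m_def g_def lam_def xa_def xb_def algebra_simps)
      ultimately have "(cmod (a - l))\<^sup>2 < (cmod (x - l))\<^sup>2"
        by (simp only: cmod_sg[OF sg])
      then show ?thesis by (rule power2_less_imp_less) simp
    qed
  qed
qed

lemma class_flat:
  assumes sg: "sg = 1 \<or> sg = -1" and C: "C w z" and "0 < sg * Re w" "0 \<le> Im w" "Im w \<le> sg * Re w" "0 \<le> Im z"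
  shows "0 < sg * Re z \<and> Im z \<le> 6/5 * (sg * Re z)"
proof (rule slope_in_class[of "sg * Re w" "Im w" "Im z" "cmod z * cmod w" st ct])
  have Czw: "C z w" using C C_sym by blast
  have ss: "sg * sg = 1" using sg by auto
  have dot: "(sg * Re z) * (sg * Re w) = Re z * Re w"
    using ss by (metis mult.assoc mult.commute mult_1)
  show "ct * (cmod z * cmod w) \<le> sg * Re z * (sg * Re w) + Im z * Im w"
    unfolding dot by (rule C_dot[OF Czw])
  have "\<bar>Im z * (sg * Re w) - sg * Re z * Im w\<bar> = \<bar>Im z * Re w - Re z * Im w\<bar>"
    using sg by auto
  then show "Im z * (sg * Re w) - sg * Re z * Im w \<le> st * (cmod z * cmod w)"
    using C_cross[OF Czw] by linarith
  show "0 < cmod z * cmod w" using C_nz C Czw by simp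
qed (use assms st ct in auto)

section \<open>The chain and its recursive repair\<close>

lemma key_leD: "key_le rk a c x \<Longrightarrow> cmod (c - a) \<le> cmod (x - a)"
  by (auto simp: key_le_def)

lemma cmod_diff_class:
  assumes "C z w" "cmod z \<le> cmod w"
  shows "cmod (w - z) < cmod w"
proof (rule cmod_diff_less)
  show "24/25 * (cmod z * cmod w) \<le> Re z * Re w + Im z * Im w"
    using C_dot[OF assms(1)] mult_right_mono[OF ct(1), of "cmod z * cmod w"] by simp
qed (use C_nz assms in auto)

text \<open>The coefficient conditions of the cost inequalities, extracted from the two equations
  that define \<open>y\<close> and \<open>x0\<close>.\<close>

lemma y_ge: "sqrt 2 * t \<le> y" "1 + t + t * st \<le> y" "1 + t * st \<le> x0" "1 \<le> y"
proof -
  have s2: "7/5 \<le> sqrt 2" by (rule real_le_rsqrt) (simp add: power2_eq_square)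
  have a: "7/5 * t \<le> sqrt 2 * t" using s2 t by (intro mult_right_mono) auto
  have b: "t * st \<le> t * (2/25)" using st t by (intro mult_left_mono) auto
  show 1: "sqrt 2 * t \<le> y" using y x0 by simp
  have "1 + t + t * st \<le> 1 + t + t * (2/25)" using b by simp
  also have "\<dots> \<le> 7/5 * t + x0" using t x0 by simp
  also have "\<dots> \<le> y" using a y by simp
  finally show "1 + t + t * st \<le> y" .
  show "1 \<le> y" using 1 a t by linarith
  have "x0 * ct \<le> x0 * 1" using x0 ct by (intro mult_left_mono) auto
  moreover have "t \<le> y" using 1 a t by linarith
  then have "t * st \<le> y * st" using st by (intro mult_right_mono) auto
  ultimately show "1 + t * st \<le> x0" using x0 by simp
qed

text \<open>A vector of slope at least 1 is at most \<open>sqrt 2\<close> times as long as it is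
  high; this is one reason for the summand \<open>sqrt 2 * t\<close> in \<open>y\<close>.\<close>

lemma steep_cost:
  assumes sg: "sg = 1 \<or> sg = -1" and "\<bar>sg * Re z\<bar> \<le> Im z"
  shows "t * cmod z \<le> y * Im z"
proof -
  have "(cmod z)\<^sup>2 \<le> (sqrt 2 * Im z)\<^sup>2"
    using assms(2) power_mono[OF assms(2), of 2]
    by (simp add: cmod_sg[OF sg] power_mult_distrib)
  then have "cmod z \<le> sqrt 2 * Im z" by (rule power2_le_imp_le) (use assms in auto)
  then have "t * cmod z \<le> (sqrt 2 * t) * Im z" using t mult_left_mono[of "cmod z" "sqrt 2 * Im z" t] by (simp add: ac_simps)
  also have "\<dots> \<le> y * Im z" using y_ge assms by (intro mult_right_mono) auto
  finally show ?thesis .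
qed

text \<open>Induction on the number of pairs of points closer together than \<open>a\<close> and
  \<open>q\<close>. The nearest candidate \<open>c\<close> splits the task: \<open>a\<close> is
  joined to \<open>c\<close> within \<open>x0 * L' + y * H\<close>, and the remaining width and drop
  pay for joining \<open>c\<close> to \<open>q\<close>.\<close>

lemma chain:
  assumes "sg = 1 \<or> sg = -1" "shadow q X sg" "q \<in> P" "a \<in> P" "up (q - a)"
    "0 < sg * Re (a - q)" "sg * Re (a - q) < X" "cmod (a - q) < r"
  shows "conn q a (x0 * (sg * Re (a - q)) + y * Im (q - a))"
  using assms
proof (induction "card {pp \<in> P \<times> P. cmod (fst pp - snd pp) < cmod (a - q)}" arbitrary: sg q X a rule: less_induct)
  case less
  note sg = less.prems(1) and S = less.prems(2) and q = less.prems(3) and a = less.prems(4)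
    and qa = less.prems(5) and L0 = less.prems(6) and LX = less.prems(7) and ar = less.prems(8)
  have IH: "conn q' a' (x0 * (sg' * Re (a' - q')) + y * Im (q' - a'))"
    if "cmod (a' - q') < cmod (a - q)" "sg' = 1 \<or> sg' = -1" "shadow q' X' sg'" "q' \<in> P" "a' \<in> P" "up (q' - a')"
      "0 < sg' * Re (a' - q')" "sg' * Re (a' - q') < X'" for q' a' sg' X'
  proof (rule less.hyps[OF _ that(2-8)])
    show "card {pp \<in> P \<times> P. cmod (fst pp - snd pp) < cmod (a' - q')}
        < card {pp \<in> P \<times> P. cmod (fst pp - snd pp) < cmod (a - q)}"
    proof (rule psubset_card_mono)
      show "finite {pp \<in> P \<times> P. cmod (fst pp - snd pp) < cmod (a - q)}" using finite_P by auto
      have "(a', q') \<in> {pp \<in> P \<times> P. cmod (fst pp - snd pp) < cmod (a - q)}" using that by simp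
      then show "{pp \<in> P \<times> P. cmod (fst pp - snd pp) < cmod (a' - q')}
        \<subset> {pp \<in> P \<times> P. cmod (fst pp - snd pp) < cmod (a - q)}" using that(1) by force
    qed
    show "cmod (a' - q') < r" using that ar by simp
  qed
  have msg: "- sg = 1 \<or> - sg = -1" using sg by auto
  define L lam where "L = sg * Re (a - q)" and "lam = Im (q - a)"
  have L: "0 < L" "0 \<le> lam" using L0 up_Im[OF qa] by (auto simp: L_def lam_def)
  have qa_sq: "(cmod (q - a))\<^sup>2 = L\<^sup>2 + lam\<^sup>2"
    by (simp only: cmod_sg[OF sg] L_def lam_def sg_swap[of sg q a])
  have goal: "x0 * (sg * Re (a - q)) + y * Im (q - a) = x0 * L + y * lam" by (simp add: L_def lam_def)
  show ?case
  proof (cases "lam \<le> L")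
    case False
    \<comment> \<open>For slope above 1 the direct path is paid for by the drop alone.\<close>
    have "conn q a (t * cmod (q - a))" using short[OF q a] ar by (simp add: norm_minus_commute)
    moreover have "t * cmod (q - a) \<le> y * lam"
      unfolding lam_def by (rule steep_cost[OF sg]) (use False L in \<open>simp add: L_def lam_def algebra_simps abs_if\<close>)
    ultimately show ?thesis
      using conn_mono L x0 unfolding goal by (metis add_increasing less_imp_le mult_nonneg_nonneg order_trans zero_le_one)
  next
    case flat: True
    have qc: "q \<in> cand q a sg" using q qa L0 by (auto simp: cand_def)
    have "finite (cand q a sg)" using finite_P by (simp add: cand_def)
    then obtain c where c: "c \<in> cand q a sg" and cmin: "\<And>x. x \<in> cand q a sg \<Longrightarrow> key_le rk a c x"
      using ex_key_min[of "cand q a sg" rk a] qc by blast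
    have cle: "cmod (c - a) \<le> cmod (x - a)" if "x \<in> cand q a sg" for x
      using key_leD[OF cmin[OF that]] .
    have cP: "c \<in> P" "c \<noteq> a" "up (c - a)" "c = q \<or> up (q - c)" "cmod (c - a) \<le> cmod (q - a)"
      using c by (auto simp: cand_def)
    define L' H where "L' = sg * Re (a - c)" and "H = Im (c - a)"
    have L': "0 < L'" using c by (simp add: cand_def L'_def)
    have H: "0 \<le> H" "H \<le> lam" using up_Im[OF cP(3)] cP(4) up_Im[of "q - c"] by (auto simp: H_def lam_def)
    have c_sq: "(cmod (c - a))\<^sup>2 = L'\<^sup>2 + H\<^sup>2"
      by (simp only: cmod_sg[OF sg] L'_def H_def sg_swap[of sg c a])
    have sq_le: "L'\<^sup>2 + H\<^sup>2 \<le> L\<^sup>2 + lam\<^sup>2"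
      using power_mono[OF cP(5), of 2] by (simp add: c_sq qa_sq)
    \<comment> \<open>As long as \<open>q\<close> has not been passed horizontally, the same shadow
      serves the rest of the chain.\<close>
    have toq: "conn q c (x0 * (L - L') + y * (lam - H))" if "L' < L" "up (q - c)"
    proof -
      have "(L - L')\<^sup>2 + (lam - H)\<^sup>2 < L\<^sup>2 + lam\<^sup>2"
      proof -
        have "(L - L')\<^sup>2 < L\<^sup>2" using that L' by (intro power_strict_mono) auto
        moreover have "(lam - H)\<^sup>2 \<le> lam\<^sup>2" using H by (intro power_mono) auto
        ultimately show ?thesis by linarith
      qed
      moreover have cq: "L - L' = sg * Re (c - q)" "lam - H = Im (q - c)"
        by (simp_all add: L_def L'_def lam_def H_def algebra_simps)
      ultimately have "(cmod (c - q))\<^sup>2 < (cmod (a - q))\<^sup>2"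
        using qa_sq by (simp only: cmod_sg[OF sg, of "c - q"] norm_minus_commute[of a q])
          (simp add: power2_commute)
      then have "cmod (c - q) < cmod (a - q)" by (rule power2_less_imp_less) simp
      from IH[OF this sg S q cP(1) that(2)] that cq LX L' show ?thesis by (simp add: L_def)
    qed
    show ?thesis
    proof (cases "H \<le> L'")
      case False
      \<comment> \<open>A steep \<open>c\<close> cannot pass \<open>q\<close>: it is no farther from
        \<open>a\<close> than \<open>q\<close>, and \<open>q\<close> is seen from \<open>a\<close>
        with slope at most 1.\<close>
      have "L' < L"
      proof (rule power2_less_imp_less)
        have "L'\<^sup>2 < H\<^sup>2" using False L' by (intro power_strict_mono) auto
        moreover have "lam\<^sup>2 \<le> L\<^sup>2" using flat L by (intro power_mono) auto
        ultimately show "L'\<^sup>2 < L\<^sup>2" using sq_le by linarith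
      qed (use L in simp)
      moreover have "c \<noteq> q" using \<open>L' < L\<close> by (auto simp: L_def L'_def)
      ultimately have 1: "conn q c (x0 * (L - L') + y * (lam - H))" using toq cP by blast
      have "conn c a (t * cmod (c - a))" using short[OF cP(1) a] cP(5) ar by (simp add: norm_minus_commute)
      moreover have "t * cmod (c - a) \<le> y * H"
        unfolding H_def by (rule steep_cost[OF sg]) (use False L' in \<open>simp add: L'_def H_def algebra_simps abs_if\<close>)
      ultimately have "conn c a (y * H)" using conn_mono by blast
      from conn_trans[OF 1 this] show ?thesis
        unfolding goal by (rule conn_mono) (use L' x0 in \<open>simp add: algebra_simps\<close>)
    next
      case cflat: True
      have SC: "shadow a L' (- sg)"
        unfolding L'_def using flat cle
        by (intro shadow_child[OF sg S q a qa L0 LX _ c]) (simp_all add: L_def lam_def)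
      have L'm: "- sg * Re (c - a) = L'" by (simp add: L'_def algebra_simps)
      \<comment> \<open>\<open>c\<close> is also nearest in its cone at \<open>a\<close>. By
        \<open>class_flat\<close> the points of that cone have slope at most \<open>6/5\<close>, so
        one that is no candidate is excluded by the second clause of the shadow.\<close>
      have yao: "key_le rk a c x" if x: "x \<in> P" "C (c - a) (x - a)" for x
      proof -
        have xa: "x \<noteq> a" using C_nz[OF C_sym[OF x(2)]] by auto
        have ux: "up (x - a)" using up_C[OF cP(3) x(2)] .
        have fl: "0 < - sg * Re (x - a) \<and> Im (x - a) \<le> 6/5 * (- sg * Re (x - a))"
          using L' H cflat up_Im[OF ux] by (intro class_flat[OF msg x(2)]) (simp_all only: L'm H_def)
        have xs: "0 < sg * Re (a - x)" using fl by (simp add: algebra_simps)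
        show ?thesis
        proof (cases "cmod (x - a) \<le> cmod (q - a)")
          case le: True
          show ?thesis
          proof (cases "x \<in> cand q a sg")
            case True then show ?thesis by (rule cmin)
          next
            case False
            note n = not_cand[OF sg L0 qa x(1) xa ux xs le False]
            have "Im (x - a) \<le> 6/5 * (sg * Re (a - x))" using fl by (simp add: algebra_simps)
            then have "cmod (q - a) < cmod (x - a)"
              using S a x(1) qa LX n unfolding shadow_def by blast
            then show ?thesis using le by simp
          qed
        next
          case False
          then have "cmod (c - a) < cmod (x - a)" using cP(5) by linarith
          then show ?thesis by (simp add: key_le_def)
        qed
      qed
      have "conn a c (x0 * L' + y * H)"
      proof -
        consider "conn a c (cmod (c - a))"
          | b where "b \<in> P" "b \<noteq> a" "C (b - c) (a - c)" "cmod (b - c) \<le> cmod (a - c)" "conn b c (cmod (b - c))"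
          using select[OF a cP(1,2) yao] by blast
        then show ?thesis
        proof cases
          case 1
          have "cmod (c - a) \<le> \<bar>Re (c - a)\<bar> + \<bar>Im (c - a)\<bar>" by (rule cmod_le)
          also have "\<dots> = L' + H" using sg L' H by (auto simp: L'_def H_def)
          also have "\<dots> \<le> x0 * L' + y * H"
            using mult_right_mono[OF x0(2), of L'] mult_right_mono[OF y_ge(4), of H] L' H by linarith
          finally show ?thesis using 1 conn_mono by blast
        next
          case (2 b)
          define zr zi where "zr = sg * Re (b - c)" and "zi = Im (c - b)"
          have Cz: "C (c - b) (c - a)" using C_neg[OF 2(3)] by simp
          have zn: "cmod (c - b) \<le> cmod (c - a)" using 2(4) by (simp add: norm_minus_commute)
          have zm: "- sg * Re (c - b) = zr" by (simp add: zr_def algebra_simps)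
          have zi0: "0 \<le> zi" using up_Im[OF up_C[OF cP(3) C_sym[OF Cz]]] by (simp add: zi_def)
          have zr0: "0 < zr"
            using class_flat[OF msg C_sym[OF Cz]] L' H cflat zi0 by (simp only: L'm zm H_def zi_def)
          have z_sq: "(cmod (c - b))\<^sup>2 = zr\<^sup>2 + zi\<^sup>2"
            by (simp only: cmod_sg[OF sg] zr_def zi_def sg_swap[of sg c b])
          have dot: "ct * (cmod (c - b) * cmod (c - a)) \<le> zr * L' + zi * H"
          proof -
            have "zr * L' = Re (c - b) * Re (c - a)" using sg by (auto simp: zr_def L'_def algebra_simps)
            then show ?thesis using C_dot[OF Cz] by (simp add: zi_def H_def)
          qed
          have cross: "\<bar>zi * L' - zr * H\<bar> \<le> st * (cmod (c - b) * cmod (c - a))"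
          proof -
            have "zi * L' - zr * H = - sg * (Im (c - b) * Re (c - a) - Re (c - b) * Im (c - a))"
              by (simp add: zr_def zi_def L'_def H_def algebra_simps)
            then have "\<bar>zi * L' - zr * H\<bar> = \<bar>Im (c - b) * Re (c - a) - Re (c - b) * Im (c - a)\<bar>"
              using sg by (auto simp: abs_mult)
            then show ?thesis using C_cross[OF Cz] by simp
          qed
          have ba: "cmod (b - a) < cmod (c - a)" using cmod_diff_class[OF Cz zn] by simp
          have bq: "cmod (b - a) < cmod (a - q)" using ba cP(5) by (simp add: norm_minus_commute)
          have na: "0 < cmod (c - a)" using cP by simp
          have ab: "sg * Re (a - b) = L' - zr" "Im (a - b) = zi - H"
            by (simp_all add: zr_def zi_def L'_def H_def algebra_simps)
          show ?thesis
          proof (cases "up (a - b)")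
            case True
            \<comment> \<open>The competitor \<open>b\<close> lies below \<open>a\<close>: a chain
              in the opposite direction, with apex \<open>a\<close>, leads to it.\<close>
            have zH: "H \<le> zi" using up_Im[OF True] ab by simp
            \<comment> \<open>Otherwise both components of the beating edge would be at least those
              of the beaten one, although it is no longer; then \<open>b = a\<close>.\<close>
            have zL: "zr < L'"
            proof (rule ccontr)
              assume n: "\<not> zr < L'"
              have "(cmod (c - b))\<^sup>2 \<le> (cmod (c - a))\<^sup>2" using zn by (intro power_mono) auto
              moreover have "L'\<^sup>2 \<le> zr\<^sup>2" "H\<^sup>2 \<le> zi\<^sup>2" using n L' H zH by (auto intro: power_mono)
              ultimately have "zr\<^sup>2 = L'\<^sup>2" "zi\<^sup>2 = H\<^sup>2" using z_sq c_sq by auto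
              then have "zr = L'" "zi = H" using zr0 L' zi0 H by (auto simp: power2_eq_iff)
              then have "b = a" using ab sg by (auto simp: complex_eq_iff)
              then show False using 2 by simp
            qed
            have "conn a b (x0 * (- sg * Re (b - a)) + y * Im (a - b))"
            proof (rule IH[OF bq msg SC a 2(1) True])
              have "- sg * Re (b - a) = L' - zr" using ab by (simp add: algebra_simps)
              then show "0 < - sg * Re (b - a)" "- sg * Re (b - a) < L'" using zL zr0 by auto
            qed
            moreover have "- sg * Re (b - a) = L' - zr" using ab by (simp add: algebra_simps)
            ultimately have "conn a b (x0 * (L' - zr) + y * (zi - H))" by (simp only: ab)
            from conn_trans[OF this 2(5)]
            have "conn a c (x0 * (L' - zr) + y * (zi - H) + cmod (c - b))" by (simp add: norm_minus_commute)
            moreover have "cmod (c - b) + y * zi \<le> x0 * zr + 2 * y * H"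
              using L' H c_sq na z_sq zn dot cross y_ge x0 yx
              by (intro spike_cost[of L' H "cmod (c - a)" _ _ _ ct st]) auto
            then have "x0 * (L' - zr) + y * (zi - H) + cmod (c - b) \<le> x0 * L' + y * H"
              by (simp add: algebra_simps)
            ultimately show ?thesis by (rule conn_mono)
          next
            case False
            have ub: "up (b - a)" and zH: "zi \<le> H" using above_up[OF False] ab by auto
            show ?thesis
            proof (cases "zr < L'")
              case True
              \<comment> \<open>A competitor above \<open>a\<close> and on the side of
                \<open>c\<close> would be a candidate closer than \<open>c\<close>.\<close>
              have bc: "b \<in> cand q a sg"
              proof (rule ccontr)
                assume nc: "b \<notin> cand q a sg"
                have "0 < sg * Re (a - b)" "cmod (b - a) \<le> cmod (q - a)"
                  using ab True ba cP(5) by auto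
                note n = not_cand[OF sg L0 qa 2(1,2) ub this nc]
                \<comment> \<open>If \<open>b\<close> is above \<open>q\<close>, it is nevertheless
                  no higher than \<open>c\<close>, and \<open>c\<close> is no higher than
                  \<open>q\<close>. So \<open>b\<close> is level with \<open>q\<close>, neither
                  steep nor at distance \<open>X\<close>, against the first clause.\<close>
                have "Im q \<le> Im b" using above_up[OF n(2)] by simp
                moreover have "Im b \<le> Im c" using zi0 by (simp add: zi_def)
                ultimately have i: "Im (b - q) = 0" using H by (simp add: H_def lam_def)
                have "(cmod (b - q))\<^sup>2 = (sg * Re (b - q))\<^sup>2" unfolding cmod_sg[OF sg] i by simp
                then have "cmod (b - q) = sg * Re (b - q)" by (rule power2_eq_imp_eq) (use n(3) in auto)
                moreover have "X \<le> cmod (b - q) \<or> 6/5 * (sg * Re (b - q)) < Im (b - q)"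
                  using S 2(1) n unfolding shadow_def by blast
                ultimately show False using n i LX by auto
              qed
              from cle[OF bc] ba show ?thesis by simp
            next
              case beyond: False
              \<comment> \<open>The competitor is above \<open>a\<close> and past it; the gap is
                short enough for a direct path.\<close>
              have "conn a b (t * cmod (b - a))"
                using short[OF a 2(1)] bq ar by (simp add: norm_minus_commute)
              from conn_trans[OF this 2(5)]
              have "conn a c (t * cmod (b - a) + cmod (c - b))" by (simp add: norm_minus_commute)
              moreover have "cmod (c - b) + t * cmod (b - a) \<le> x0 * L' + y * H"
              proof (rule beyond_cost[of L' H "cmod (c - a)" _ zr zi])
                have "cmod (b - a) \<le> \<bar>Re (b - a)\<bar> + \<bar>Im (b - a)\<bar>" by (rule cmod_le)
                also have "\<dots> = \<bar>sg * Re (a - b)\<bar> + \<bar>Im (a - b)\<bar>" using sg by (auto simp: abs_minus_commute)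
                also have "\<dots> = (zr - L') + (H - zi)" unfolding ab using beyond zH by simp
                finally show "cmod (b - a) \<le> (zr - L') + (H - zi)" .
                show "- (st * (cmod (c - b) * cmod (c - a))) \<le> zi * L' - zr * H" using cross by linarith
              qed (use L' H cflat c_sq z_sq zn beyond zH st t y_ge in auto)
              then have "t * cmod (b - a) + cmod (c - b) \<le> x0 * L' + y * H" by simp
              ultimately show ?thesis by (rule conn_mono)
            qed
          qed
        qed
      qed
      then have ca: "conn c a (x0 * L' + y * H)" by (rule conn_sym)
      show ?thesis
      proof (cases "c = q")
        case True
        then show ?thesis using ca unfolding goal by (simp add: L_def L'_def lam_def H_def)
      next
        case False
        then have upc: "up (q - c)" using cP by simp
        show ?thesis
        proof (cases "L' < L")
          case True
          from conn_trans[OF toq[OF True upc] ca] show ?thesis unfolding goal by (simp add: algebra_simps)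
        next
          case over: False
          \<comment> \<open>The edge passes \<open>q\<close>. Of the two summands of
            \<open>y\<close>, \<open>sqrt 2 * t\<close> pays for the direct path from
            \<open>q\<close> to \<open>c\<close> and \<open>x0\<close> for the excess width.\<close>
          have del: "L' - L \<le> lam - H"
            using L over flat H sq_le by (intro overshoot_cost) auto
          have qc_sq: "(cmod (q - c))\<^sup>2 = (L' - L)\<^sup>2 + (lam - H)\<^sup>2"
          proof -
            have "L' - L = sg * Re (q - c)" "lam - H = Im (q - c)"
              by (simp_all add: L_def L'_def lam_def H_def algebra_simps)
            then show ?thesis by (simp only: cmod_sg[OF sg])
          qed
          have "(L' - L)\<^sup>2 \<le> (lam - H)\<^sup>2" using del over by (intro power_mono) auto
          moreover have "(lam - H)\<^sup>2 \<le> lam\<^sup>2" using H by (intro power_mono) auto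
          moreover have "lam\<^sup>2 \<le> L\<^sup>2" using flat L by (intro power_mono) auto
          ultimately have le: "(cmod (q - c))\<^sup>2 \<le> (cmod (a - q))\<^sup>2"
            and le2: "(cmod (q - c))\<^sup>2 \<le> (sqrt 2 * (lam - H))\<^sup>2"
            using qa_sq qc_sq by (auto simp: norm_minus_commute power_mult_distrib)
          have "cmod (q - c) \<le> cmod (a - q)" using le by (rule power2_le_imp_le) simp
          then have 1: "conn q c (t * cmod (q - c))" using short[OF q cP(1)] ar by simp
          have "cmod (q - c) \<le> sqrt 2 * (lam - H)" using le2 by (rule power2_le_imp_le) (use H in simp)
          then have "t * cmod (q - c) \<le> sqrt 2 * t * (lam - H)"
            using t mult_left_mono[of "cmod (q - c)" "sqrt 2 * (lam - H)" t] by (simp add: ac_simps)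
          moreover have "x0 * (L' - L) \<le> x0 * (lam - H)" using del x0 by (intro mult_left_mono) auto
          ultimately have "t * cmod (q - c) + (x0 * L' + y * H) \<le> x0 * L + y * lam"
            unfolding y by (simp add: algebra_simps)
          with conn_trans[OF 1 ca] show ?thesis unfolding goal using conn_mono by blast
        qed
      qed
    qed
  qed
qed

section \<open>The first edge of a window\<close>

lemma shadow_origin:
  assumes "\<And>x. x \<in> P \<Longrightarrow> x \<noteq> 0 \<Longrightarrow> \<not> up (- x) \<Longrightarrow> 0 < Re x \<Longrightarrow> X \<le> cmod x"
  shows "shadow 0 X 1"
  unfolding shadow_def
proof (intro conjI ballI impI)
  fix l x
  assume "l \<in> P" "x \<in> P"
    and h: "up (0 - l) \<and> 1 * Re (l - 0) < X \<and> x \<noteq> 0 \<and> \<not> up (0 - x) \<and> 0 < 1 * Re (x - 0) \<and>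
      1 * Re (x - 0) < 1 * Re (l - 0) \<and> Im (x - l) \<le> 6/5 * (1 * Re (l - x))"
  then show "cmod (0 - l) < cmod (x - l)"
    using assms[of x] by (intro shadow_visible[of 1 0 l x X]) auto
qed (use assms in auto)

text \<open>One side of the window is the positive real axis, \<open>v\<close> is its nearest point
  and \<open>b\<close> beats the edge to \<open>v\<close>. The free quadrant above the axis is a
  shadow of the origin, so a chain with apex 0 leads to \<open>b\<close>, followed by the edge from
  \<open>b\<close> to \<open>v\<close>.\<close>

lemma window_edge:
  assumes P: "0 \<in> P" "b \<in> P" and v: "cmod v = r" "0 < r" "0 \<le> Im v"
    and b: "b \<noteq> 0" "C (b - v) (0 - v)" "cmod (b - v) \<le> r" "conn b v (cmod (b - v))"
    and low: "0 < Re b" "up (- b)"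
    and empty: "\<And>x. x \<in> P \<Longrightarrow> x \<noteq> 0 \<Longrightarrow> \<not> up (- x) \<Longrightarrow> 0 < Re x \<Longrightarrow> r \<le> cmod x"
  shows "conn 0 v (x0 * (1 + st) * r)"
proof -
  have Cz: "C (v - b) v" using C_neg[OF b(2)] by simp
  have zv: "cmod (v - b) \<le> cmod v" using b(3) v by (simp add: norm_minus_commute)
  have br: "cmod b < r" using cmod_diff_class[OF Cz zv] v by simp
  have Rb: "Re b < r" using br complex_Re_le_cmod[of b] by linarith
  have "conn 0 b (x0 * (1 * Re (b - 0)) + y * Im (0 - b))"
    using P low br Rb by (intro chain[where X = r]) (auto intro: shadow_origin empty)
  then have "conn 0 b (x0 * Re b + y * (- Im b))" by simp
  from conn_trans[OF this b(4)]
  have "conn 0 v (x0 * Re b + y * (- Im b) + cmod (v - b))" by (simp add: norm_minus_commute)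
  moreover have "x0 * Re b + y * (- Im b) + cmod (v - b) \<le> x0 * (1 + st) * r"
  proof -
    define zr zi z where "zr = Re (v - b)" and "zi = Im (v - b)" and "z = cmod (v - b)"
    have zle: "z \<le> r" using zv v by (simp add: z_def)
    have dot: "ct * (z * r) \<le> zr * Re v + zi * Im v" using C_dot[OF Cz] v by (simp add: zr_def zi_def z_def)
    have cross: "\<bar>zi * Re v - zr * Im v\<bar> \<le> st * (z * r)" using C_cross[OF Cz] v by (simp add: zr_def zi_def z_def)
    have rsq: "r\<^sup>2 = (Re v)\<^sup>2 + (Im v)\<^sup>2" using cmod_power2[of v] v by simp
    have zsq: "z\<^sup>2 = zr\<^sup>2 + zi\<^sup>2" by (simp add: z_def zr_def zi_def cmod_power2)
    \<comment> \<open>Since \<open>v - b\<close> is no longer than \<open>v\<close>, the inner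
      product of \<open>b\<close> and \<open>v\<close> is nonnegative, while their imaginary parts
      have opposite signs or vanish.\<close>
    have "0 \<le> Re v"
    proof -
      have "(zr * Re v + zi * Im v)\<^sup>2 + (zi * Re v - zr * Im v)\<^sup>2 = (z * r)\<^sup>2"
        unfolding power_mult_distrib rsq zsq by (simp add: power2_eq_square algebra_simps)
      then have "(zr * Re v + zi * Im v)\<^sup>2 \<le> (z * r)\<^sup>2"
        using zero_le_power2[of "zi * Re v - zr * Im v"] by linarith
      then have "zr * Re v + zi * Im v \<le> z * r" by (rule power2_le_imp_le) (use v in \<open>simp add: z_def\<close>)
      also have "\<dots> \<le> r\<^sup>2" using zle v by (simp add: power2_eq_square)
      finally have "0 \<le> Re b * Re v + Im b * Im v"
        using rsq by (simp add: zr_def zi_def power2_eq_square algebra_simps)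
      moreover have "Im b * Im v \<le> 0" using up_Im[OF low(2)] v by (simp add: mult_le_0_iff)
      ultimately have "0 \<le> Re b * Re v" by linarith
      then show ?thesis using low by (simp add: zero_le_mult_iff)
    qed
    then have "z + x0 * (Re v - zr) + y * (zi - Im v) \<le> x0 * (1 + st) * r"
      using v rsq zsq zle dot cross x0 y_ge(4) st
      by (intro edge_cost[where ct = ct]) (auto simp: z_def)
    then show ?thesis by (simp add: zr_def zi_def z_def)
  qed
  ultimately show ?thesis by (rule conn_mono)
qed

end

section \<open>Paths and their lengths\<close>

inductive reach :: "(complex \<Rightarrow> complex \<Rightarrow> bool) \<Rightarrow> complex set \<Rightarrow> complex \<Rightarrow> complex \<Rightarrow> real \<Rightarrow> bool"
  for E P where
  refl: "a \<in> P \<Longrightarrow> reach E P a a 0"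
| step: "a \<in> P \<Longrightarrow> E a b \<or> E b a \<Longrightarrow> reach E P b c s \<Longrightarrow> reach E P a c (cmod (b - a) + s)"

lemma reach_in: "reach E P a b s \<Longrightarrow> a \<in> P \<and> b \<in> P"
  by (induction rule: reach.induct) auto

lemma reach_trans: "reach E P a b s \<Longrightarrow> reach E P b c s' \<Longrightarrow> reach E P a c (s + s')"
  by (induction rule: reach.induct) (auto simp: add.assoc intro: reach.step)

lemma reach_edge:
  assumes "a \<in> P" "b \<in> P" "E a b \<or> E b a"
  shows "reach E P a b (cmod (b - a))"
  using reach.step[OF assms(1,3) reach.refl[OF assms(2)]] by simp

lemma reach_sym: "reach E P a b s \<Longrightarrow> reach E P b a s"
proof (induction rule: reach.induct)
  case (step a b c s)
  have "reach E P b a (cmod (a - b))" using step reach_in[of E P b c s] by (intro reach_edge) auto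
  from reach_trans[OF step.IH this] show ?case by (simp add: norm_minus_commute add.commute)
qed (rule reach.refl)

lemma reach_walk:
  "reach E P a b s \<Longrightarrow> \<exists>xs. xs \<noteq> [] \<and> hd xs = a \<and> last xs = b \<and> set xs \<subseteq> P \<and> is_walk E xs \<and> walk_length xs = s"
proof (induction rule: reach.induct)
  case (refl a)
  then show ?case by (intro exI[of _ "[a]"]) simp
next
  case (step a b c s)
  then obtain xs where xs: "xs \<noteq> []" "hd xs = b" "last xs = c" "set xs \<subseteq> P" "is_walk E xs" "walk_length xs = s"
    by blast
  then obtain ys where "xs = b # ys" by (cases xs) auto
  then show ?case using xs step.hyps by (intro exI[of _ "a # xs"]) auto
qed

text \<open>\<open>reach\<close> records exact lengths, as needed to recover a walk; an upper bound
  is what the cost estimates combine.\<close>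

definition conn :: "(complex \<Rightarrow> complex \<Rightarrow> bool) \<Rightarrow> complex set \<Rightarrow> complex \<Rightarrow> complex \<Rightarrow> real \<Rightarrow> bool" where
  "conn E P a b s \<longleftrightarrow> (\<exists>s'\<le>s. reach E P a b s')"

lemma conn_sym: "conn E P a b s \<Longrightarrow> conn E P b a s"
  using reach_sym by (auto simp: conn_def)

lemma conn_trans: "conn E P a b s \<Longrightarrow> conn E P b c s' \<Longrightarrow> conn E P a c (s + s')"
  unfolding conn_def by (metis add_mono reach_trans)

lemma conn_mono: "conn E P a b s \<Longrightarrow> s \<le> s' \<Longrightarrow> conn E P a b s'"
  unfolding conn_def by (meson order_trans)

section \<open>Polar angles and cones\<close>

lemma polar_angle_bounds: "0 \<le> polar_angle z" "polar_angle z < 2 * pi"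
  using mpi_less_Arg[of z] Arg_le_pi[of z] pi_gt_zero by (auto simp: polar_angle_def simp del: pi_gt_zero)

lemma polar_angle_eq: "z = of_real (cmod z) * cis (polar_angle z)"
proof -
  have "cis (polar_angle z) = cis (Arg z)" by (simp add: polar_angle_def complex_eq_iff)
  then show ?thesis using rcis_cmod_Arg[of z] by (simp add: rcis_def)
qed

text \<open>The cone index as an integer, so that rotation by cones becomes addition modulo
  \<open>2 * int k\<close>.\<close>

definition sector :: "nat \<Rightarrow> complex \<Rightarrow> int" where
  "sector k z = \<lfloor>polar_angle z * real k / pi\<rfloor>"

lemma sector_bounds:
  assumes "0 < k"
  shows "0 \<le> sector k z" "sector k z < 2 * int k"
proof -
  show "0 \<le> sector k z" using polar_angle_bounds[of z] by (simp add: sector_def)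
  have "polar_angle z * real k < 2 * pi * real k"
    using polar_angle_bounds[of z] assms by (intro mult_strict_right_mono) auto
  then have "polar_angle z * real k / pi < 2 * real k" by (simp add: field_simps)
  then show "sector k z < 2 * int k" unfolding sector_def by (simp add: floor_less_iff)
qed

lemma sector_cis:
  assumes "0 < k" "0 < r" "z = of_real r * cis \<phi>"
  shows "sector k z = \<lfloor>\<phi> * real k / pi\<rfloor> mod (2 * int k)"
proof -
  have r: "cmod z = r" using assms by (simp add: norm_mult)
  have "of_real r * cis (polar_angle z) = of_real r * cis \<phi>"
    using polar_angle_eq[of z] assms(3) unfolding r by metis
  then have "cis (polar_angle z) = cis \<phi>" using assms by simp
  then have "sin (polar_angle z) = sin \<phi> \<and> cos (polar_angle z) = cos \<phi>"
    by (simp add: complex_eq_iff)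
  then obtain n :: int where n: "polar_angle z = \<phi> + 2 * pi * of_int n"
    using sin_cos_eq_iff by blast
  have "polar_angle z * real k / pi = \<phi> * real k / pi + of_int (2 * int k * n)"
    unfolding n by (simp add: field_simps)
  then have "sector k z = \<lfloor>\<phi> * real k / pi\<rfloor> + 2 * int k * n"
    unfolding sector_def by (simp only: floor_add_int[symmetric])
  moreover have "sector k z mod (2 * int k) = sector k z"
    using sector_bounds[OF assms(1), of z] by simp
  ultimately show ?thesis by (metis mod_mult_self2)
qed

lemma yao_cone_sector:
  assumes "0 < k"
  shows "v \<in> yao_cone (2 * k) u j \<longleftrightarrow> v \<noteq> u \<and> sector k (v - u) = int j"
proof -
  have "sector k (v - u) = int j \<longleftrightarrow>
      real j \<le> polar_angle (v - u) * real k / pi \<and> polar_angle (v - u) * real k / pi < real j + 1"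
    unfolding sector_def by (subst floor_eq_iff) simp
  also have "\<dots> \<longleftrightarrow> 2 * real j * pi / real (2 * k) \<le> polar_angle (v - u) \<and>
      polar_angle (v - u) < 2 * real (Suc j) * pi / real (2 * k)"
  proof -
    have "2 * real i * pi / real (2 * k) \<le> x \<longleftrightarrow> real i \<le> x * real k / pi" for i x
      using assms by (simp add: field_simps)
    then show ?thesis by (metis not_le of_nat_Suc add.commute)
  qed
  finally show ?thesis by (auto simp: yao_cone_def cone_def)
qed

definition same_cone :: "nat \<Rightarrow> complex \<Rightarrow> complex \<Rightarrow> bool" where
  "same_cone k z w \<longleftrightarrow> z \<noteq> 0 \<and> w \<noteq> 0 \<and> sector k z = sector k w"

lemma same_cone_rotate:
  assumes "0 < k"
  shows "same_cone k (cis (of_int p * pi / real k) * z) (cis (of_int p * pi / real k) * w) \<longleftrightarrow> same_cone k z w"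
proof -
  have rot: "sector k (cis (of_int p * pi / real k) * z) = (sector k z + p) mod (2 * int k)" if "z \<noteq> 0" for z
  proof -
    have e: "cis (of_int p * pi / real k) * z = of_real (cmod z) * cis (polar_angle z + of_int p * pi / real k)"
      by (subst polar_angle_eq[of z]) (simp add: cis_mult ac_simps)
    have "(polar_angle z + of_int p * pi / real k) * real k / pi = polar_angle z * real k / pi + of_int p"
      using assms by (simp add: field_simps)
    then show ?thesis
      using sector_cis[OF assms _ e] that by (simp add: sector_def)
  qed
  have "(sector k z + p) mod (2 * int k) = (sector k w + p) mod (2 * int k) \<longleftrightarrow> sector k z = sector k w"
  proof
    assume "(sector k z + p) mod (2 * int k) = (sector k w + p) mod (2 * int k)"
    then have "(sector k z + p - p) mod (2 * int k) = (sector k w + p - p) mod (2 * int k)"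
      by (rule mod_diff_cong) simp
    then show "sector k z = sector k w" using sector_bounds[OF assms, of z] sector_bounds[OF assms, of w] by simp
  qed simp
  then show ?thesis using rot by (auto simp: same_cone_def)
qed

text \<open>Negation is rotation by \<open>k\<close> cones; this is where the number of cones being
  even enters.\<close>

lemma same_cone_neg:
  assumes "0 < k" "same_cone k z w"
  shows "same_cone k (- z) (- w)"
proof -
  have "cis (of_int (int k) * pi / real k) = -1" using assms by simp
  then show ?thesis using same_cone_rotate[OF assms(1), of "int k" z w] assms(2) by simp
qed

lemma same_cone_angle:
  assumes "0 < k" "same_cone k z w"
  shows "\<bar>polar_angle z - polar_angle w\<bar> < pi / real k"
proof -
  have "\<bar>polar_angle z * real k / pi - polar_angle w * real k / pi\<bar> < 1"
    using assms(2) unfolding same_cone_def sector_def by linarith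
  also have "polar_angle z * real k / pi - polar_angle w * real k / pi = (polar_angle z - polar_angle w) * (real k / pi)"
    by (simp add: field_simps)
  finally have "\<bar>polar_angle z - polar_angle w\<bar> * (real k / pi) < 1" by (simp add: abs_mult)
  then show ?thesis using assms(1) by (simp add: field_simps)
qed

lemma cmod_polar: "Re z = cmod z * cos (polar_angle z)" "Im z = cmod z * sin (polar_angle z)"
proof -
  have "Re z = Re (of_real (cmod z) * cis (polar_angle z))" "Im z = Im (of_real (cmod z) * cis (polar_angle z))"
    using polar_angle_eq[of z] by simp_all
  then show "Re z = cmod z * cos (polar_angle z)" "Im z = cmod z * sin (polar_angle z)" by simp_all
qed

lemma same_cone_dot:
  assumes "2 \<le> k" "same_cone k z w"
  shows "cos (pi / real k) * (cmod z * cmod w) \<le> Re z * Re w + Im z * Im w"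
proof -
  define d where "d = polar_angle z - polar_angle w"
  have "\<bar>d\<bar> < pi / real k" using same_cone_angle[of k z w] assms by (simp add: d_def)
  moreover have "pi / real k \<le> pi" using assms by (simp add: field_simps)
  ultimately have "cos (pi / real k) \<le> cos \<bar>d\<bar>" by (intro cos_monotone_0_pi_le) auto
  then have "cos (pi / real k) * (cmod z * cmod w) \<le> cos d * (cmod z * cmod w)"
    by (intro mult_right_mono) auto
  also have "\<dots> = Re z * Re w + Im z * Im w"
    by (simp add: d_def cos_diff cmod_polar[of z] cmod_polar[of w] algebra_simps)
  finally show ?thesis .
qed

lemma same_cone_cross:
  assumes "2 \<le> k" "same_cone k z w"
  shows "\<bar>Im z * Re w - Re z * Im w\<bar> \<le> sin (pi / real k) * (cmod z * cmod w)"
proof -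
  define d where "d = polar_angle z - polar_angle w"
  have d: "\<bar>d\<bar> < pi / real k" using same_cone_angle[of k z w] assms by (simp add: d_def)
  moreover have k2: "pi / real k \<le> pi / 2" using assms by (intro divide_left_mono) auto
  ultimately have "sin \<bar>d\<bar> \<le> sin (pi / real k)" by (intro sin_monotone_2pi_le) (use pi_ge_zero abs_ge_zero[of d] in linarith)+
  moreover have "0 \<le> sin \<bar>d\<bar>" using d k2 by (intro sin_ge_zero) (use pi_ge_zero in linarith)+
  ultimately have "\<bar>sin d\<bar> \<le> sin (pi / real k)" by (auto simp: abs_if split: if_splits)
  then have "\<bar>sin d\<bar> * (cmod z * cmod w) \<le> sin (pi / real k) * (cmod z * cmod w)"
    by (intro mult_right_mono) auto
  moreover have "Im z * Re w - Re z * Im w = sin d * (cmod z * cmod w)"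
    by (simp add: d_def sin_diff cmod_polar[of z] cmod_polar[of w] algebra_simps)
  ultimately show ?thesis by (simp add: abs_mult)
qed

lemma sector_Im:
  assumes "0 < k"
  shows "sector k z < int k \<Longrightarrow> 0 \<le> Im z" "int k \<le> sector k z \<Longrightarrow> Im z \<le> 0"
proof -
  assume "sector k z < int k"
  then have "polar_angle z * real k / pi < real k" unfolding sector_def by linarith
  then have "polar_angle z < pi" using assms by (simp add: field_simps)
  then show "0 \<le> Im z" using polar_angle_bounds[of z] by (simp add: cmod_polar sin_ge_zero)
next
  assume "int k \<le> sector k z"
  then have "real k \<le> polar_angle z * real k / pi" unfolding sector_def by linarith
  then have "pi \<le> polar_angle z" using assms by (simp add: field_simps)
  then have "sin (polar_angle z) \<le> 0"
    using polar_angle_bounds[of z] by (intro sin_le_zero) auto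
  then show "Im z \<le> 0" by (simp add: cmod_polar mult_nonneg_nonpos)
qed

lemma same_cone_Im:
  assumes "0 < k" "same_cone k z w"
  shows "0 \<le> Im z * Im w"
proof (cases "sector k z < int k")
  case True
  then show ?thesis using sector_Im(1)[OF assms(1), of z] sector_Im(1)[OF assms(1), of w] assms(2) by (simp add: same_cone_def)
next
  case False
  then show ?thesis using sector_Im(2)[OF assms(1), of z] sector_Im(2)[OF assms(1), of w] assms(2)
    by (simp add: same_cone_def mult_nonpos_nonpos)
qed

text \<open>By \<open>near\<close> the edge from \<open>a\<close> to \<open>c\<close> is a Yao edge,
  so \<open>a\<close> competes at \<open>c\<close> within its cone there; the Yao-Yao graph keeps
  the winner \<open>b\<close> of this competition.\<close>

lemma yao_yao_select:
  assumes k: "0 < k" and P: "finite P" "a \<in> P" "c \<in> P" "c \<noteq> a"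
    and near: "\<And>x. x \<in> P \<Longrightarrow> same_cone k (c - a) (x - a) \<Longrightarrow> key_le rk a c x"
  defines "E \<equiv> yy_edge (2 * k) rk P"
  shows "conn E P a c (cmod (c - a)) \<or>
    (\<exists>b\<in>P. b \<noteq> a \<and> same_cone k (b - c) (a - c) \<and> cmod (b - c) \<le> cmod (a - c) \<and> conn E P b c (cmod (b - c)))"
proof -
  have edge: "conn E P b c (cmod (b - c))" if "b \<in> P" "E b c" for b
    using reach_edge[of b P c E] that P by (auto simp: conn_def norm_minus_commute)
  have ex: "\<exists>j<2 * k. x \<in> yao_cone (2 * k) y j" if "x \<noteq> y" for x y
  proof -
    have "sector k (x - y) = int (nat (sector k (x - y)))" "nat (sector k (x - y)) < 2 * k"
      using sector_bounds[OF k, of "x - y"] by auto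
    then show ?thesis using that yao_cone_sector[OF k] by blast
  qed
  obtain i where i: "i < 2 * k" "c \<in> yao_cone (2 * k) a i" using ex P by blast
  have yac: "yao_edge (2 * k) rk P a c"
    unfolding yao_edge_def
  proof (intro conjI exI[of _ i] ballI)
    fix w assume "w \<in> P \<inter> yao_cone (2 * k) a i"
    then show "key_le rk a c w" using i near[of w] yao_cone_sector[OF k] by (auto simp: same_cone_def)
  qed (use P i in auto)
  obtain j where j: "j < 2 * k" "a \<in> yao_cone (2 * k) c j" using ex P by metis
  define A where "A = {w \<in> P \<inter> yao_cone (2 * k) c j. yao_edge (2 * k) rk P w c}"
  have aA: "a \<in> A" using P j yac by (simp add: A_def)
  have "finite A" using P by (simp add: A_def)
  then obtain b where b: "b \<in> A" "\<forall>x\<in>A. key_le rk c b x" using ex_key_min[of A rk c] aA by blast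
  have "E b c" unfolding E_def yy_edge_def using b j P by (auto simp: A_def)
  moreover have "same_cone k (b - c) (a - c)" "b \<in> P" "cmod (b - c) \<le> cmod (a - c)"
    using b aA yao_cone_sector[OF k] by (auto simp: A_def same_cone_def key_le_def)
  ultimately show ?thesis using edge by (cases "b = a") (auto simp: norm_minus_commute)
qed

text \<open>The constant 187/2500 is a rational just above \<open>pi / 42\<close>.\<close>

lemma pi_over_bounds:
  assumes "42 \<le> k"
  shows "0 < pi / real k" "pi / real k \<le> 187/2500"
proof -
  show "0 < pi / real k" using assms by simp
  have "pi / real k \<le> pi / 42" using assms by (intro divide_left_mono) auto
  then show "pi / real k \<le> 187/2500" using pi_approx by simp
qed

lemma cos_ge_quadratic: "1 - x\<^sup>2 / 2 \<le> cos x" for x :: real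
proof -
  have "\<bar>sin (x / 2)\<bar> \<le> \<bar>x / 2\<bar>" by (rule abs_sin_x_le_abs_x)
  then have "(sin (x / 2))\<^sup>2 \<le> (x / 2)\<^sup>2" by (rule abs_le_square_iff[THEN iffD1])
  moreover have "cos x = 1 - 2 * (sin (x / 2))\<^sup>2" using cos_double_sin[of "x / 2"] by simp
  ultimately show ?thesis by (simp add: power_divide)
qed

lemma sin_cos_pi_over:
  assumes "42 \<le> k"
  shows "0 < sin (pi / real k)" "sin (pi / real k) \<le> 187/2500" "2491/2500 \<le> cos (pi / real k)"
proof -
  note b = pi_over_bounds[OF assms]
  show "0 < sin (pi / real k)" using b pi_gt3 by (intro sin_gt_zero) linarith+
  show "sin (pi / real k) \<le> 187/2500" using sin_x_le_x[of "pi / real k"] b by linarith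
  have "(pi / real k)\<^sup>2 \<le> (187/2500)\<^sup>2" using b by (intro power_mono) auto
  then show "2491/2500 \<le> cos (pi / real k)"
    using cos_ge_quadratic[of "pi / real k"] by (simp add: power2_eq_square)
qed

text \<open>Angles are lifted to the real line, so that a window crossing the positive real axis is
  still an interval.\<close>

lemma same_cone_lift:
  assumes "0 < k" "0 < r" "z = of_real r * cis \<alpha>" "same_cone k z w"
  shows "\<exists>\<phi>. w = of_real (cmod w) * cis \<phi> \<and> \<lfloor>\<phi> * real k / pi\<rfloor> = \<lfloor>\<alpha> * real k / pi\<rfloor>"
proof -
  define n where "n = \<lfloor>\<alpha> * real k / pi\<rfloor> div (2 * int k)"
  define \<phi> where "\<phi> = polar_angle w + 2 * pi * of_int n"
  have "sector k w = \<lfloor>\<alpha> * real k / pi\<rfloor> mod (2 * int k)"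
    using sector_cis[OF assms(1-3)] assms(4) by (simp add: same_cone_def)
  then have "\<lfloor>\<alpha> * real k / pi\<rfloor> = sector k w + 2 * int k * n" by (simp add: n_def)
  moreover have "\<phi> * real k / pi = polar_angle w * real k / pi + of_int (2 * int k * n)"
    by (simp add: \<phi>_def field_simps)
  then have "\<lfloor>\<phi> * real k / pi\<rfloor> = sector k w + 2 * int k * n"
    unfolding sector_def by (simp only: floor_add_int[symmetric])
  moreover have "cis \<phi> = cis (polar_angle w)"
    using sin_cos_eq_iff[of \<phi> "polar_angle w"] by (auto simp: \<phi>_def complex_eq_iff)
  ultimately show ?thesis using polar_angle_eq[of w] by metis
qed

section \<open>Windows and the induction on distance\<close>

text \<open>\<open>x0\<close> and \<open>y\<close> are the prices of horizontal extent and drop.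
  \<open>stretch\<close> weighs the cost of the first step, per unit of \<open>r\<close>, against
  \<open>t\<close> times the progress it makes.\<close>

locale yao_yao =
  fixes k :: nat and P :: "complex set" and rk :: "complex \<Rightarrow> nat" and t x0 y :: real
  assumes k: "42 \<le> k"
    and finite_P: "finite P"
    and t: "1 \<le> t"
    and y: "y = sqrt 2 * t + x0"
    and x0: "x0 * cos (pi / real k) = 1 + y * sin (pi / real k)" "1 \<le> x0"
    and yx: "1 \<le> y - x0 * sin (pi / real k)"
    and stretch: "x0 * (1 + sin (pi / real k)) \<le> t * (1 - 2 * sin (pi / 8 + 5 * (pi / real k) / 8))"
begin

abbreviation \<theta> :: real where "\<theta> \<equiv> pi / real k"
abbreviation link :: "complex \<Rightarrow> complex \<Rightarrow> real \<Rightarrow> bool" where "link \<equiv> conn (yy_edge (2 * k) rk P) P"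

text \<open>Both ends of a window are brought to the positive real axis, the upper end by a reflection,
  which leaves the cones closed on the other side.\<close>

lemma frame:
  fixes u :: complex and p :: int
  assumes h: "h = (\<lambda>z. z) \<or> h = cnj"
    and short: "\<And>a b. a \<in> P \<Longrightarrow> b \<in> P \<Longrightarrow> cmod (a - b) < r \<Longrightarrow> link a b (t * cmod (a - b))"
  defines "g \<equiv> \<lambda>x. u + cis (of_int p * pi / real k) * h x"
  shows "yao_frame {x. g x \<in> P} (\<lambda>z w. same_cone k (h z) (h w)) (\<lambda>x. rk (g x))
    (\<lambda>a b. link (g a) (g b)) (cos \<theta>) (sin \<theta>) t r x0 y"
proof -
  have hd: "h (a - b) = h a - h b" "h (- a) = - h a" "cmod (h a) = cmod a" "h a = 0 \<longleftrightarrow> a = 0" for a b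
    using h by auto
  have gd: "g a - g b = cis (of_int p * pi / real k) * h (a - b)" for a b
    by (simp add: g_def hd algebra_simps)
  have gn: "cmod (g a - g b) = cmod (a - b)" for a b
    unfolding gd norm_mult hd(3) by simp
  have gs: "same_cone k (g a - g b) (g c - g d) \<longleftrightarrow> same_cone k (h (a - b)) (h (c - d))" for a b c d
    unfolding gd using same_cone_rotate[of k p] k by simp
  have inj: "inj g" using gn by (intro injI) (metis norm_eq_zero right_minus_eq)
  have surj: "\<exists>x. z = g x" for z
    using h
  proof
    assume "h = (\<lambda>z. z)"
    then show ?thesis by (intro exI[of _ "(z - u) * cis (- (of_int p * pi / real k))"]) (simp add: g_def cis_mult ac_simps flip: mult.assoc)
  next
    assume "h = cnj"
    then show ?thesis by (intro exI[of _ "cnj ((z - u) * cis (- (of_int p * pi / real k)))"]) (simp add: g_def cis_mult cis_cnj ac_simps flip: mult.assoc)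
  qed
  note sc = sin_cos_pi_over[OF k]
  show ?thesis
  proof
    show "finite {x. g x \<in> P}"
      using finite_vimageI[OF finite_P inj] by (simp add: vimage_def)
    show "cos \<theta> * (cmod z * cmod w) \<le> Re z * Re w + Im z * Im w" if "same_cone k (h z) (h w)" for z w
      using same_cone_dot[OF _ that] k h by auto
    show "\<bar>Im z * Re w - Re z * Im w\<bar> \<le> sin \<theta> * (cmod z * cmod w)" if "same_cone k (h z) (h w)" for z w
      using same_cone_cross[OF _ that] k h by (auto simp: abs_minus_commute)
    show "0 \<le> Im z * Im w" if "same_cone k (h z) (h w)" for z w
      using same_cone_Im[OF _ that] k h by auto
    show "same_cone k (h (- z)) (h (- w))" if "same_cone k (h z) (h w)" for z w
      using same_cone_neg[OF _ that] k by (simp add: hd)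
    show "link (g a) (g b) (t * cmod (a - b))"
      if "a \<in> {x. g x \<in> P}" "b \<in> {x. g x \<in> P}" "cmod (a - b) < r" for a b
      using short[of "g a" "g b"] that by (simp add: gn)
    show "link (g a) (g c) (cmod (c - a)) \<or>
        (\<exists>b\<in>{x. g x \<in> P}. b \<noteq> a \<and> same_cone k (h (b - c)) (h (a - c)) \<and> cmod (b - c) \<le> cmod (a - c) \<and>
          link (g b) (g c) (cmod (b - c)))"
      if ac: "a \<in> {x. g x \<in> P}" "c \<in> {x. g x \<in> P}" "c \<noteq> a"
        and near: "\<And>x. x \<in> {x. g x \<in> P} \<Longrightarrow> same_cone k (h (c - a)) (h (x - a)) \<Longrightarrow> key_le (\<lambda>x. rk (g x)) a c x"
      for a c
    proof -
      have "key_le rk (g a) (g c) x" if x: "x \<in> P" "same_cone k (g c - g a) (x - g a)" for x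
      proof -
        obtain x' where x': "x = g x'" using surj by blast
        then show ?thesis using near[of x'] x by (simp add: gs gn key_le_def)
      qed
      moreover have "g c \<noteq> g a" using inj ac(3) by (auto dest: injD)
      ultimately have "link (g a) (g c) (cmod (g c - g a)) \<or>
        (\<exists>b\<in>P. b \<noteq> g a \<and> same_cone k (b - g c) (g a - g c) \<and> cmod (b - g c) \<le> cmod (g a - g c) \<and>
          link b (g c) (cmod (b - g c)))"
        using yao_yao_select[of k P "g a" "g c" rk] k finite_P ac by auto
      then show ?thesis
      proof
        assume "\<exists>b\<in>P. b \<noteq> g a \<and> same_cone k (b - g c) (g a - g c) \<and>
          cmod (b - g c) \<le> cmod (g a - g c) \<and> link b (g c) (cmod (b - g c))"
        then obtain b where b: "b \<in> P" "b \<noteq> g a" "same_cone k (b - g c) (g a - g c)"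
          "cmod (b - g c) \<le> cmod (g a - g c)" "link b (g c) (cmod (b - g c))" by blast
        obtain b' where b': "b = g b'" using surj by blast
        show ?thesis using b unfolding b' gs gn by (intro disjI2 bexI[of _ b']) auto
      qed (simp add: gn)
    qed
  qed (use t y x0 yx sc hd in \<open>auto simp: same_cone_def intro: conn_sym conn_trans conn_mono\<close>)
qed

text \<open>A competitor \<open>b\<close> is closer to \<open>u\<close> than the nearest point of
  the window and its direction is within a right angle of that point, so it lies beyond one side of
  the window. As the window is at least \<open>pi / 2\<close> wide, the quadrant on the inner side
  of that side contains no point closer than \<open>r\<close>, and \<open>window_edge\<close>
  applies.\<close>

lemma window_link:
  fixes p n :: int
  assumes n: "pi / 2 \<le> of_int n * \<theta>" "of_int n * \<theta> \<le> pi"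
    and P: "u \<in> P" "u + of_real r * cis \<alpha> \<in> P" and r: "0 < r"
    and \<alpha>: "of_int p * \<theta> \<le> \<alpha>" "\<alpha> < of_int (p + n) * \<theta>"
    and near: "\<And>s \<phi>. u + of_real s * cis \<phi> \<in> P \<Longrightarrow> 0 < s \<Longrightarrow> of_int p * \<theta> \<le> \<phi> \<Longrightarrow>
        \<phi> < of_int (p + n) * \<theta> \<Longrightarrow> key_le rk u (u + of_real r * cis \<alpha>) (u + of_real s * cis \<phi>)"
    and short: "\<And>a b. a \<in> P \<Longrightarrow> b \<in> P \<Longrightarrow> cmod (a - b) < r \<Longrightarrow> link a b (t * cmod (a - b))"
  shows "link u (u + of_real r * cis \<alpha>) (x0 * (1 + sin \<theta>) * r)"
proof -
  define z where "z = of_real r * cis \<alpha>"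
  have k0: "0 < k" "0 < pi / real k" using k by auto
  have pn: "of_int (p + n) * \<theta> = of_int p * \<theta> + of_int n * \<theta>" by (simp only: of_int_add distrib_right)
  have cz: "cmod z = r" "z \<noteq> 0" using r by (auto simp: z_def norm_mult)
  have nearr: "r \<le> s" if "u + of_real s * cis \<phi> \<in> P" "0 < s" "of_int p * \<theta> \<le> \<phi>" "\<phi> < of_int (p + n) * \<theta>" for s \<phi>
    using near[OF that] r that(2) by (auto simp: key_le_def norm_mult)
  have floor: "of_int p * \<theta> \<le> \<phi> \<and> \<phi> < of_int (p + n) * \<theta> \<longleftrightarrow> p \<le> \<lfloor>\<phi> * real k / pi\<rfloor> \<and> \<lfloor>\<phi> * real k / pi\<rfloor> < p + n" for \<phi>
    using k0 by (simp add: le_floor_iff floor_less_iff field_simps)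
  have sel: "link u (u + z) (cmod (u + z - u)) \<or>
    (\<exists>b\<in>P. b \<noteq> u \<and> same_cone k (b - (u + z)) (u - (u + z)) \<and> cmod (b - (u + z)) \<le> cmod (u - (u + z)) \<and>
      link b (u + z) (cmod (b - (u + z))))"
  proof (rule yao_yao_select)
    fix x assume x: "x \<in> P" "same_cone k (u + z - u) (x - u)"
    then obtain \<phi> where \<phi>: "x - u = of_real (cmod (x - u)) * cis \<phi>" "\<lfloor>\<phi> * real k / pi\<rfloor> = \<lfloor>\<alpha> * real k / pi\<rfloor>"
      using same_cone_lift[OF k0(1) r z_def, of "x - u"] by auto
    have xe: "x = u + of_real (cmod (x - u)) * cis \<phi>" using \<phi>(1) by (simp add: algebra_simps)
    have "0 < cmod (x - u)" using x(2) by (simp add: same_cone_def)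
    moreover have "of_int p * \<theta> \<le> \<phi> \<and> \<phi> < of_int (p + n) * \<theta>" using \<alpha> floor[of \<phi>] floor[of \<alpha>] \<phi>(2) by simp
    ultimately have "key_le rk u (u + of_real r * cis \<alpha>) (u + of_real (cmod (x - u)) * cis \<phi>)"
      using near[of "cmod (x - u)" \<phi>] x(1) xe by metis
    then show "key_le rk u (u + z) x" using xe by (simp add: z_def)
  qed (use k0 finite_P P cz in \<open>auto simp: z_def\<close>)
  have x01: "r \<le> x0 * (1 + sin \<theta>) * r"
  proof -
    have "1 * 1 \<le> x0 * (1 + sin \<theta>)" using x0(2) sin_cos_pi_over(1)[OF k] by (intro mult_mono) auto
    then show ?thesis using r by simp
  qed
  show ?thesis
  proof (cases "link u (u + z) (cmod (u + z - u))")
    case True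
    then show ?thesis using conn_mono[OF True, of "x0 * (1 + sin \<theta>) * r"] x01 cz(1) by (simp add: z_def)
  next
    case False
    then obtain b where b: "b \<in> P" "b \<noteq> u" "same_cone k (b - (u + z)) (u - (u + z))"
      "cmod (b - (u + z)) \<le> cmod (u - (u + z))" "link b (u + z) (cmod (b - (u + z)))" using sel by blast
    define w where "w = b - u"
    have w0: "w \<noteq> 0" using b by (simp add: w_def)
    have be: "b = u + w" by (simp add: w_def)
    have wz: "cmod (w - z) \<le> r" using b(4) cz(1) by (simp add: w_def algebra_simps)
    \<comment> \<open>From \<open>cmod (w - z) \<le> cmod z\<close> and
      \<open>w \<noteq> 0\<close>.\<close>
    have dot: "0 < Re (w * cis (- \<alpha>))"
    proof -
      have "(cmod (w - z))\<^sup>2 \<le> r\<^sup>2" using wz by (intro power_mono) auto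
      moreover have "0 < (cmod w)\<^sup>2" using w0 by simp
      moreover have "(cmod z)\<^sup>2 = r\<^sup>2" using cz by simp
      ultimately have "0 < Re w * Re z + Im w * Im z"
        unfolding cmod_power2 by (simp add: power2_eq_square algebra_simps)
      also have "\<dots> = r * Re (w * cis (- \<alpha>))" by (simp add: z_def algebra_simps)
      finally show ?thesis using r by (simp add: zero_less_mult_iff)
    qed
    define \<psi> where "\<psi> = Arg (w * cis (- \<alpha>))"
    have \<psi>: "\<bar>\<psi>\<bar> < pi / 2" using dot Arg_Re_pos[of "w * cis (- \<alpha>)"] by (simp add: \<psi>_def)
    have we: "w = of_real (cmod w) * cis (\<alpha> + \<psi>)"
    proof -
      have "w * cis (- \<alpha>) = of_real (cmod w) * cis \<psi>"
        using rcis_cmod_Arg[of "w * cis (- \<alpha>)"] by (simp add: rcis_def \<psi>_def norm_mult)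
      then have "w * cis (- \<alpha>) * cis \<alpha> = of_real (cmod w) * (cis \<psi> * cis \<alpha>)" by simp
      moreover have "w * cis (- \<alpha>) * cis \<alpha> = w" by (simp add: cis_mult mult.assoc)
      ultimately show ?thesis by (simp add: cis_mult add.commute)
    qed
    have wr: "cmod w < r"
    proof -
      have c: "same_cone k (z - w) z" using same_cone_neg[OF k0(1) b(3)] by (simp add: w_def algebra_simps)
      have "24/25 * (cmod (z - w) * cmod z) \<le> cos \<theta> * (cmod (z - w) * cmod z)"
        using sin_cos_pi_over(3)[OF k] by (intro mult_right_mono) auto
      also have "\<dots> \<le> Re (z - w) * Re z + Im (z - w) * Im z" using same_cone_dot[OF _ c] k by simp
      finally have "cmod (z - (z - w)) < cmod z"
        using c wz cz(1) by (intro cmod_diff_less) (auto simp: same_cone_def norm_minus_commute)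
      then show ?thesis using cz(1) by simp
    qed
    have out: "\<not> (of_int p * \<theta> \<le> \<alpha> + \<psi> \<and> \<alpha> + \<psi> < of_int (p + n) * \<theta>)"
      using nearr[of "cmod w" "\<alpha> + \<psi>"] b(1) we be w0 wr by (metis not_le zero_less_norm_iff)
    show ?thesis
    proof (cases "\<alpha> + \<psi> < of_int p * \<theta>")
      case True
      interpret yao_frame "{x. u + cis (of_int p * pi / real k) * x \<in> P}" "\<lambda>z w. same_cone k z w"
        "\<lambda>x. rk (u + cis (of_int p * pi / real k) * x)"
        "\<lambda>a b. link (u + cis (of_int p * pi / real k) * a) (u + cis (of_int p * pi / real k) * b)"
        "cos \<theta>" "sin \<theta>" t r x0 y
        using frame[of "\<lambda>z. z" r u p] short by simp
      let ?c = "of_int p * pi / real k"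
      let ?z = "of_real r * cis (\<alpha> - ?c)" and ?w = "of_real (cmod w) * cis (\<alpha> + \<psi> - ?c)"
      have ez: "cis ?c * ?z = z" and ew: "cis ?c * ?w = w"
        by (simp add: z_def cis_mult mult.left_commute) (subst (2) we, simp add: cis_mult mult.left_commute)
      have ewz: "same_cone k (?w - ?z) (0 - ?z) \<longleftrightarrow> same_cone k (b - (u + z)) (u - (u + z))"
        using same_cone_rotate[OF k0(1), of p "?w - ?z" "0 - ?z"] unfolding right_diff_distrib ez ew
        by (simp add: w_def algebra_simps)
      have dwz: "cmod (?w - ?z) = cmod (w - z)"
        using norm_mult[of "cis ?c" "?w - ?z"] unfolding right_diff_distrib ez ew by simp
      have "link (u + cis ?c * 0) (u + cis ?c * ?z) (x0 * (1 + sin \<theta>) * r)"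
      proof (rule window_edge[of ?w])
        show "0 \<le> Im ?z" using \<alpha> n r by (simp add: sin_ge_zero algebra_simps)
        show "up (- ?w)"
        proof (rule upI)
          have "sin (\<alpha> + \<psi> - ?c) < 0" using True \<psi> \<alpha> by (intro sin_less_zero) auto
          then show "0 < Im (- ?w)" using w0 by (simp add: mult_pos_neg)
        qed
        show "same_cone k (?w - ?z) (0 - ?z)" using ewz b(3) by blast
        have "0 < cos (\<alpha> + \<psi> - ?c)" using True \<psi> \<alpha> pi_gt_zero unfolding times_divide_eq_right by (intro cos_gt_zero_pi) linarith+
        then show "0 < Re ?w" using w0 by simp
        show "link (u + cis ?c * ?w) (u + cis ?c * ?z) (cmod (?w - ?z))"
          unfolding ez ew dwz using b(5) by (simp add: w_def algebra_simps)
        fix x assume x: "x \<in> {x. u + cis ?c * x \<in> P}" "x \<noteq> 0" "\<not> up (- x)" "0 < Re x"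
        then have "0 \<le> Im x" using upI[of "- x"] by force
        then have a: "0 \<le> Arg x" "Arg x < pi / 2" using x(4) Arg_Re_pos[of x] by (auto simp: Arg_less_0)
        have "cis ?c * x = of_real (cmod x) * cis (?c + Arg x)"
          using rcis_cmod_Arg[of x] by (metis (no_types) cis_mult mult.left_commute rcis_def)
        moreover have "of_int p * \<theta> \<le> ?c + Arg x" "?c + Arg x < of_int (p + n) * \<theta>"
          using a n pn unfolding times_divide_eq_right by linarith+
        ultimately show "r \<le> cmod x" using nearr[of "cmod x" "?c + Arg x"] x by simp
      qed (use P b w0 r wz k in \<open>auto simp: ez ew dwz norm_mult be simp flip: z_def\<close>)
      then show ?thesis unfolding ez by (simp add: z_def)
    next
      case False
      let ?c = "of_int (p + n) * pi / real k"
      have ge: "?c \<le> \<alpha> + \<psi>" using out False by simp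
      interpret yao_frame "{x. u + cis ?c * cnj x \<in> P}" "\<lambda>z w. same_cone k (cnj z) (cnj w)"
        "\<lambda>x. rk (u + cis ?c * cnj x)" "\<lambda>a b. link (u + cis ?c * cnj a) (u + cis ?c * cnj b)"
        "cos \<theta>" "sin \<theta>" t r x0 y
        using frame[of cnj r u "p + n"] short by simp
      \<comment> \<open>The half-open window excludes its upper side; accordingly, points on the
        positive real axis count as below it after the reflection.\<close>
      have up2: "up (- x)" if "Im x \<le> 0" "0 < Re x" for x
      proof (cases "Im x = 0")
        case True
        have xe: "cnj (- x) = of_real (Re x) * cis pi" using True by (simp add: complex_eq_iff)
        have s: "sector k (cnj (- x)) = int k" using sector_cis[OF k0(1) that(2) xe] k0 by simp
        show ?thesis unfolding up_def
        proof (intro allI impI)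
          fix v assume "same_cone k (cnj (- x)) (cnj v)"
          then have "Im (cnj v) \<le> 0" using s sector_Im(2)[OF k0(1), of "cnj v"] by (simp add: same_cone_def)
          then show "0 \<le> Im v" by simp
        qed
      qed (use that in \<open>auto intro: upI\<close>)
      let ?z = "of_real r * cis (?c - \<alpha>)" and ?w = "of_real (cmod w) * cis (?c - (\<alpha> + \<psi>))"
      have ez: "cis ?c * cnj ?z = z" and ew: "cis ?c * cnj ?w = w"
        by (simp add: z_def cis_mult cis_cnj mult.left_commute) (subst (2) we, simp add: cis_mult cis_cnj mult.left_commute)
      have ewz: "same_cone k (cnj (?w - ?z)) (cnj (0 - ?z)) \<longleftrightarrow> same_cone k (b - (u + z)) (u - (u + z))"
        using same_cone_rotate[OF k0(1), of "p + n" "cnj (?w - ?z)" "cnj (0 - ?z)"]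
        unfolding complex_cnj_diff right_diff_distrib ez ew by (simp add: w_def algebra_simps)
      have dwz: "cmod (?w - ?z) = cmod (w - z)"
      proof -
        have "cis ?c * cnj (?w - ?z) = w - z" by (simp only: complex_cnj_diff right_diff_distrib ez ew)
        then have "cmod (cis ?c * cnj (?w - ?z)) = cmod (w - z)" by (simp only:)
        then show ?thesis by (simp only: norm_mult norm_cis complex_mod_cnj mult_1)
      qed
      have sz: "0 \<le> sin (?c - \<alpha>)"
        using \<alpha> pn n unfolding times_divide_eq_right by (intro sin_ge_zero) linarith+
      have cw: "0 < cos (?c - (\<alpha> + \<psi>))" using ge \<psi> \<alpha> pi_gt_zero unfolding times_divide_eq_right by (intro cos_gt_zero_pi) linarith+
      have "link (u + cis ?c * cnj 0) (u + cis ?c * cnj ?z) (x0 * (1 + sin \<theta>) * r)"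
      proof (rule window_edge[of ?w])
        show "0 \<le> Im ?z" using sz r by simp
        show "up (- ?w)"
        proof (rule up2)
          have "0 \<le> sin (\<alpha> + \<psi> - ?c)" using ge \<psi> \<alpha> pi_gt_zero unfolding times_divide_eq_right by (intro sin_ge_zero) linarith+
          then have "sin (?c - (\<alpha> + \<psi>)) \<le> 0" using sin_minus[of "\<alpha> + \<psi> - ?c"] by simp
          then show "Im ?w \<le> 0" by (simp add: mult_nonneg_nonpos)
          show "0 < Re ?w" using w0 cw by simp
        qed
        show "0 < Re ?w" using w0 cw by simp
        show "?w \<in> {x. u + cis ?c * cnj x \<in> P}" unfolding mem_Collect_eq ew using b(1) be by simp
        show "cmod (?w - ?z) \<le> r" unfolding dwz by (rule wz)
        show "same_cone k (cnj (?w - ?z)) (cnj (0 - ?z))" using ewz b(3) by blast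
        show "link (u + cis ?c * cnj ?w) (u + cis ?c * cnj ?z) (cmod (?w - ?z))"
          unfolding ez ew dwz using b(5) by (simp add: w_def algebra_simps)
        fix x assume x: "x \<in> {x. u + cis ?c * cnj x \<in> P}" "x \<noteq> 0" "\<not> up (- x)" "0 < Re x"
        then have "0 < Im x" using up2[of x] by force
        then have a: "0 < Arg x" "Arg x < pi / 2"
          using x(4) Arg_Re_pos[of x] Arg_less_0[of x] Arg_eq_0[of x] by (auto simp: less_le complex_is_Real_iff)
        have "cis ?c * cnj x = of_real (cmod x) * cis (?c - Arg x)"
          using rcis_cmod_Arg[of x] by (metis (no_types) cis_cnj cis_mult complex_cnj_complex_of_real complex_cnj_mult diff_conv_add_uminus mult.left_commute rcis_def)
        moreover have "of_int p * \<theta> \<le> ?c - Arg x" "?c - Arg x < of_int (p + n) * \<theta>"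
          using a n pn unfolding times_divide_eq_right by linarith+
        ultimately show "r \<le> cmod x" using nearr[of "cmod x" "?c - Arg x"] x by simp
      qed (use P b w0 r wz k in \<open>auto simp: ez ew dwz norm_mult be simp flip: z_def\<close>)
      then show ?thesis unfolding ez by (simp add: z_def)
    qed
  qed
qed

lemma spanner:
  assumes "u \<in> P" "v \<in> P"
  shows "link u v (t * cmod (v - u))"
  using assms
proof (induction "card {q \<in> P \<times> P. cmod (snd q - fst q) < cmod (v - u)}" arbitrary: u v rule: less_induct)
  case less
  have IH: "link a b (t * cmod (b - a))" if "a \<in> P" "b \<in> P" "cmod (b - a) < cmod (v - u)" for a b
  proof (rule less.hyps)
    show "card {q \<in> P \<times> P. cmod (snd q - fst q) < cmod (b - a)} < card {q \<in> P \<times> P. cmod (snd q - fst q) < cmod (v - u)}"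
    proof (rule psubset_card_mono)
      have "(a, b) \<in> {q \<in> P \<times> P. cmod (snd q - fst q) < cmod (v - u)} - {q \<in> P \<times> P. cmod (snd q - fst q) < cmod (b - a)}"
        using that by simp
      moreover have "{q \<in> P \<times> P. cmod (snd q - fst q) < cmod (b - a)} \<subseteq> {q \<in> P \<times> P. cmod (snd q - fst q) < cmod (v - u)}"
        using that by auto
      ultimately show "{q \<in> P \<times> P. cmod (snd q - fst q) < cmod (b - a)} \<subset> {q \<in> P \<times> P. cmod (snd q - fst q) < cmod (v - u)}"
        by blast
    qed (use finite_P in simp)
  qed (use that in auto)
  show ?case
  proof (cases "v = u")
    case True
    then show ?thesis using reach.refl[OF less.prems(1)] by (auto simp: conn_def)
  next
    case False
    define l where "l = cmod (v - u)"
    define \<beta> where "\<beta> = polar_angle (v - u)"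
    \<comment> \<open>The least \<open>J\<close> for which \<open>2 * J + 1\<close> cones, with the
      cone of \<open>v\<close> in the middle, open by at least \<open>pi / 2\<close>, that is
      \<open>k \<le> 4 * J + 2\<close>. Directions in the window differ from that of
      \<open>v\<close> by at most \<open>J + 1\<close> cone angles, and
      \<open>4 * J \<le> k + 1\<close>.\<close>
    define J where "J = (int k + 1) div 4"
    define q where "q = \<lfloor>\<beta> * real k / pi\<rfloor>"
    define p where "p = q - J"
    define n where "n = 2 * J + 1"
    have l: "0 < l" using False by (simp add: l_def)
    have ve: "v = u + of_real l * cis \<beta>"
      using polar_angle_eq[of "v - u"] by (simp add: l_def \<beta>_def algebra_simps)
    have th: "0 < \<theta>" using k by simp
    have kth: "real k * \<theta> = pi" using k by simp
    have J: "of_int (int k) \<le> (of_int (4 * J + 2) :: real)" "of_int (4 * J) \<le> (of_int (int k + 1) :: real)"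
      "0 \<le> J" "4 * J + 2 \<le> 2 * int k"
      unfolding J_def of_int_le_iff using k by linarith+
    have n: "pi / 2 \<le> of_int n * \<theta>" "of_int n * \<theta> \<le> pi"
    proof -
      have "real k * \<theta> \<le> (2 * of_int n) * \<theta>" using J(1) th by (intro mult_right_mono) (auto simp: n_def)
      then show "pi / 2 \<le> of_int n * \<theta>" unfolding kth mult.assoc by linarith
      have "of_int n * \<theta> \<le> of_int (int k) * \<theta>" using J(4) th unfolding n_def
        by (intro mult_right_mono, unfold of_int_le_iff) auto
      then show "of_int n * \<theta> \<le> pi" using kth by simp
    qed
    have \<beta>: "of_int q * \<theta> \<le> \<beta>" "\<beta> < of_int (q + 1) * \<theta>"
    proof -
      have "of_int q \<le> \<beta> * real k / pi" "\<beta> * real k / pi < of_int (q + 1)"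
        unfolding q_def by linarith+
      then show "of_int q * \<theta> \<le> \<beta>" "\<beta> < of_int (q + 1) * \<theta>"
        using k by (simp_all add: field_simps)
    qed
    define A where "A = {x \<in> P. \<exists>s \<phi>. x = u + of_real s * cis \<phi> \<and> 0 < s \<and> of_int p * \<theta> \<le> \<phi> \<and> \<phi> < of_int (p + n) * \<theta>}"
    have quarter: "4 * a \<le> b + c \<Longrightarrow> a + c \<le> b / 4 + 5 * c / 4" for a b c :: real by simp
    have gap: "a1 \<le> b \<Longrightarrow> b < a1 + h \<Longrightarrow> a1 - j \<le> a \<Longrightarrow> a < a1 + j + h \<Longrightarrow> j + h \<le> w \<Longrightarrow> \<bar>b - a\<bar> \<le> w"
      for a a1 b h j w :: real by linarith
    have collect: "(a - b) + (2 * b + c) = a + b + c" for a b c :: real by simp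
    have pq: "of_int p * \<theta> = of_int q * \<theta> - of_int J * \<theta>"
      "of_int (p + n) * \<theta> = of_int q * \<theta> + of_int J * \<theta> + \<theta>"
      "of_int (q + 1) * \<theta> = of_int q * \<theta> + \<theta>"
      unfolding p_def n_def of_int_add of_int_diff of_int_mult of_int_numeral of_int_1 left_diff_distrib distrib_right mult_1 mult.assoc collect
      by (simp_all only:)
    have J\<theta>: "0 \<le> of_int J * \<theta>" "of_int J * \<theta> + \<theta> \<le> pi / 4 + 5 * \<theta> / 4"
    proof -
      show "0 \<le> of_int J * \<theta>" using J(3) by simp
      have "(4 * of_int J) * \<theta> \<le> (real k + 1) * \<theta>" using J(2) th by (intro mult_right_mono) auto
      also have "\<dots> = pi + \<theta>" using kth by (simp only: distrib_right mult_1)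
      finally show "of_int J * \<theta> + \<theta> \<le> pi / 4 + 5 * \<theta> / 4" unfolding mult.assoc by (rule quarter)
    qed
    have "v \<in> A" unfolding A_def using less.prems(2) ve l \<beta> J\<theta>(1) pq th
      by (intro CollectI conjI exI[of _ l] exI[of _ \<beta>]) linarith+
    moreover have "finite A" using finite_P by (simp add: A_def)
    ultimately obtain v0 where v0: "v0 \<in> A" "\<forall>x\<in>A. key_le rk u v0 x" using ex_key_min[of A rk u] by blast
    then obtain r \<alpha> where r: "v0 \<in> P" "v0 = u + of_real r * cis \<alpha>" "0 < r" "of_int p * \<theta> \<le> \<alpha>" "\<alpha> < of_int (p + n) * \<theta>"
      by (auto simp: A_def)
    have rl: "r \<le> l"
      using v0(2) \<open>v \<in> A\<close> r(2,3) by (auto simp: key_le_def l_def norm_mult)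
    have step: "link u v0 (x0 * (1 + sin \<theta>) * r)"
      unfolding r(2)
    proof (rule window_link[OF n less.prems(1) _ r(3-5)])
      show "u + of_real r * cis \<alpha> \<in> P" using r by simp
      show "key_le rk u (u + of_real r * cis \<alpha>) (u + of_real s * cis \<phi>)"
        if "u + of_real s * cis \<phi> \<in> P" "0 < s" "of_int p * \<theta> \<le> \<phi>" "\<phi> < of_int (p + n) * \<theta>" for s \<phi>
        using v0(2) that unfolding A_def r(2) by blast
      show "link a b (t * cmod (a - b))" if "a \<in> P" "b \<in> P" "cmod (a - b) < r" for a b
        using IH[of a b] that rl by (simp add: l_def norm_minus_commute)
    qed
    define \<sigma> where "\<sigma> = 2 * sin (pi / 8 + 5 * \<theta> / 8)"
    \<comment> \<open>The way from \<open>v0\<close> to \<open>v\<close> is split at the point of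
      the segment from \<open>u\<close> to \<open>v\<close> at distance \<open>r\<close>; the first
      part is a chord of the circle of radius \<open>r\<close> about \<open>u\<close>.\<close>
    have diff: "cmod (v - v0) \<le> l - r + \<sigma> * r"
    proof -
      have "v - v0 = of_real (l - r) * cis \<beta> + of_real r * (cis \<beta> - cis \<alpha>)"
        unfolding ve r(2) by (simp add: algebra_simps)
      then have "cmod (v - v0) \<le> \<bar>l - r\<bar> + \<bar>r\<bar> * cmod (cis \<beta> - cis \<alpha>)"
        by (metis norm_triangle_ineq norm_mult norm_of_real norm_cis mult.right_neutral)
      moreover have "cmod (cis \<beta> - cis \<alpha>) \<le> \<sigma>"
      proof -
        have "(cmod (cis \<beta> - cis \<alpha>))\<^sup>2 = (2 * sin (\<bar>\<beta> - \<alpha>\<bar> / 2))\<^sup>2"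
        proof -
          have "(cmod (cis \<beta> - cis \<alpha>))\<^sup>2 = ((cos \<beta>)\<^sup>2 + (sin \<beta>)\<^sup>2) + ((cos \<alpha>)\<^sup>2 + (sin \<alpha>)\<^sup>2) - 2 * cos (\<beta> - \<alpha>)"
            unfolding cmod_power2 by (simp add: cos_diff power2_eq_square algebra_simps)
          also have "\<dots> = 2 - 2 * cos \<bar>\<beta> - \<alpha>\<bar>" by simp
          also have "cos \<bar>\<beta> - \<alpha>\<bar> = 1 - 2 * (sin (\<bar>\<beta> - \<alpha>\<bar> / 2))\<^sup>2"
            using cos_double_sin[of "\<bar>\<beta> - \<alpha>\<bar> / 2"] by simp
          finally show ?thesis by (simp add: power_mult_distrib)
        qed
        moreover have b: "\<bar>\<beta> - \<alpha>\<bar> \<le> pi / 4 + 5 * \<theta> / 4"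
          using \<beta> r(4,5) unfolding pq by (intro gap[OF _ _ _ _ J\<theta>(2)])
        obtain h where h: "\<theta> = h" by blast
        have th2: "h \<le> 187/2500" using pi_over_bounds(2)[OF k] unfolding h .
        have "0 \<le> sin (\<bar>\<beta> - \<alpha>\<bar> / 2)" using b[unfolded h] th2 pi_gt3 by (intro sin_ge_zero) simp_all
        ultimately have "cmod (cis \<beta> - cis \<alpha>) = 2 * sin (\<bar>\<beta> - \<alpha>\<bar> / 2)"
          by - (rule power2_eq_imp_eq, auto)
        also have "\<dots> \<le> \<sigma>"
          unfolding \<sigma>_def h using b[unfolded h] th2 pi_gt3 by (intro mult_left_mono sin_monotone_2pi_le) simp_all
        finally show ?thesis .
      qed
      then have "r * cmod (cis \<beta> - cis \<alpha>) \<le> \<sigma> * r" using r(3) by (simp add: mult.commute)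
      moreover have "\<bar>l - r\<bar> = l - r" "\<bar>r\<bar> = r" using rl r(3) by simp_all
      ultimately show ?thesis by simp
    qed
    \<comment> \<open>The left side of \<open>stretch\<close> is positive, hence
      \<open>\<sigma> < 1\<close> and \<open>v0\<close> is strictly closer to \<open>v\<close> than
      \<open>u\<close> is.\<close>
    have "0 < x0 * (1 + sin \<theta>)" using x0(2) sin_cos_pi_over(1)[OF k] by simp
    then have "0 < t * (1 - \<sigma>)" using stretch by (simp add: \<sigma>_def)
    then have "0 < 1 - \<sigma>" using t by (simp add: zero_less_mult_iff)
    then have "0 < r * (1 - \<sigma>)" using r(3) by simp
    then have "cmod (v - v0) < l" using diff by (simp add: algebra_simps)
    then have "link v0 v (t * cmod (v - v0))" using IH[OF r(1) less.prems(2)] by (simp add: l_def)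
    from conn_trans[OF step this]
    have "link u v (x0 * (1 + sin \<theta>) * r + t * cmod (v - v0))" .
    moreover have "x0 * (1 + sin \<theta>) * r + t * cmod (v - v0) \<le> t * l"
    proof -
      have "x0 * (1 + sin \<theta>) * r \<le> t * (1 - \<sigma>) * r"
        using stretch r(3) unfolding \<sigma>_def by (intro mult_right_mono) auto
      moreover have "t * cmod (v - v0) \<le> t * (l - r + \<sigma> * r)" using diff t by (intro mult_left_mono) auto
      ultimately show ?thesis by (simp add: algebra_simps)
    qed
    ultimately show ?thesis unfolding l_def by (rule conn_mono)
  qed
qed

end

section \<open>The stretch factor and its limit\<close>

lemma sqrt2_bounds: "141421/100000 \<le> sqrt 2" "sqrt 2 \<le> 141422/100000"
proof -
  show "141421/100000 \<le> sqrt 2" by (rule real_le_rsqrt) (simp add: power2_eq_square)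
  show "sqrt 2 \<le> 141422/100000" by (rule real_le_lsqrt) (simp_all add: power2_eq_square)
qed

lemma sin_cos_pi8_le: "sin (pi / 8) \<le> 3827/10000" "cos (pi / 8) \<le> 9239/10000"
proof -
  have c: "cos (2 * (pi / 8)) = sqrt 2 / 2" by (simp add: cos_45)
  have "(sin (pi / 8))\<^sup>2 = (1 - sqrt 2 / 2) / 2" using cos_double_sin[of "pi / 8"] unfolding c by (simp add: field_simps)
  then have "(sin (pi / 8))\<^sup>2 \<le> (3827/10000)\<^sup>2" using sqrt2_bounds by (simp add: power2_eq_square)
  then show "sin (pi / 8) \<le> 3827/10000" by (rule power2_le_imp_le) simp
  have "(cos (pi / 8))\<^sup>2 = (1 + sqrt 2 / 2) / 2" using cos_double_cos[of "pi / 8"] unfolding c by (simp add: field_simps)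
  then have "(cos (pi / 8))\<^sup>2 \<le> (9239/10000)\<^sup>2" using sqrt2_bounds by (simp add: power2_eq_square)
  then show "cos (pi / 8) \<le> 9239/10000" by (rule power2_le_imp_le) simp
qed

text \<open>The coefficient of \<open>t\<close> in \<open>stretch\<close> after the part of
  \<open>x0 * (1 + sin x)\<close> proportional to \<open>t\<close> is moved to the right
  side.\<close>

definition gain :: "real \<Rightarrow> real" where
  "gain x = 1 - 2 * sin (pi / 8 + 5 * x / 8) - sqrt 2 * sin x * (1 + sin x) / (cos x - sin x)"

text \<open>The least \<open>t\<close> satisfying \<open>stretch\<close> at cone angle
  \<open>x\<close>, provided \<open>gain x\<close> is positive.\<close>

definition ratio :: "real \<Rightarrow> real" where
  "ratio x = (1 + sin x) / (cos x - sin x) / gain x"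

text \<open>At \<open>k = 42\<close> the two subtracted terms are still at most 86/100 and
  13/100.\<close>

lemma gain_pos:
  assumes "42 \<le> k"
  shows "0 < gain (pi / real k)"
proof -
  define x where "x = pi / real k"
  note b = pi_over_bounds[OF assms, folded x_def] and sc = sin_cos_pi_over[OF assms, folded x_def]
  have "sin (pi / 8 + 5 * x / 8) \<le> sin (pi / 8) + cos (pi / 8) * (5 * x / 8)"
  proof -
    have p: "0 \<le> sin (pi / 8)" "0 \<le> cos (pi / 8)" by (auto intro!: sin_ge_zero cos_ge_zero)
    have "sin (pi / 8) * cos (5 * x / 8) \<le> sin (pi / 8) * 1" using p by (intro mult_left_mono) auto
    moreover have "cos (pi / 8) * sin (5 * x / 8) \<le> cos (pi / 8) * (5 * x / 8)"
      using p b by (intro mult_left_mono sin_x_le_x) auto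
    ultimately show ?thesis by (simp add: sin_add)
  qed
  moreover have "cos (pi / 8) * (5 * x / 8) \<le> 9239/10000 * (5 * (187/2500) / 8)"
    using sin_cos_pi8_le b by (intro mult_mono) auto
  ultimately have "2 * sin (pi / 8 + 5 * x / 8) \<le> 86/100" using sin_cos_pi8_le by linarith
  moreover have "sqrt 2 * sin x * (1 + sin x) / (cos x - sin x) \<le> 13/100"
  proof -
    have "sqrt 2 * sin x * (1 + sin x) \<le> 141422/100000 * (187/2500) * (1 + 187/2500)"
      using sqrt2_bounds sc by (intro mult_mono) auto
    also have "\<dots> \<le> 13/100 * (cos x - sin x)" using sc by simp
    finally show ?thesis using sc by (simp add: divide_le_eq)
  qed
  ultimately show ?thesis unfolding gain_def x_def[symmetric] by linarith
qed

lemma ratio_lim: "(\<lambda>k. ratio (pi / real k)) \<longlonglongrightarrow> 1 / (1 - 2 * sin (pi / 8))"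
proof -
  have "1 - 2 * sin (pi / 8) \<noteq> 0" using sin_cos_pi8_le by simp
  then have "isCont ratio 0" unfolding ratio_def gain_def by (intro continuous_intros) auto
  moreover have "(\<lambda>k. pi / real k) \<longlonglongrightarrow> 0" by (rule lim_const_over_n)
  ultimately have "(\<lambda>k. ratio (pi / real k)) \<longlonglongrightarrow> ratio 0" by (rule isCont_tendsto_compose)
  then show ?thesis by (simp add: ratio_def gain_def)
qed

lemma yao_yao_spanner:
  assumes k: "42 \<le> k" and P: "finite P" and t: "1 \<le> t" "ratio (pi / real k) \<le> t"
  shows "geometric_spanner P (yy_edge (2 * k) rk P) t"
proof -
  define x where "x = pi / real k"
  \<comment> \<open>The solution of \<open>x0 * cos x = 1 + y * sin x\<close> with
    \<open>y = sqrt 2 * t + x0\<close>.\<close>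
  define x0 where "x0 = (1 + sqrt 2 * t * sin x) / (cos x - sin x)"
  note sc = sin_cos_pi_over[OF k, folded x_def]
  have d: "0 < cos x - sin x" using sc by linarith
  have st: "0 \<le> sqrt 2 * t * sin x" using t sc by simp
  have x0d: "x0 * (cos x - sin x) = 1 + sqrt 2 * t * sin x" using d by (simp add: x0_def)
  have x01: "1 \<le> x0"
    unfolding x0_def using d st cos_le_one[of x] sc(1) by (simp add: le_divide_eq del: cos_le_one)
  interpret yao_yao k P rk t x0 "sqrt 2 * t + x0"
  proof
    show "x0 * cos (pi / real k) = 1 + (sqrt 2 * t + x0) * sin (pi / real k)"
      using x0d unfolding x_def by (simp add: algebra_simps)
    have "x0 * sin x \<le> x0 * 1" using x01 by (intro mult_left_mono) auto
    moreover have "1 * 1 \<le> sqrt 2 * t" using t sqrt2_bounds by (intro mult_mono) auto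
    ultimately show "1 \<le> sqrt 2 * t + x0 - x0 * sin (pi / real k)" unfolding x_def by linarith
    have "(1 + sin x) / (cos x - sin x) \<le> t * gain x"
      using t(2) unfolding ratio_def x_def pos_divide_le_eq[OF gain_pos[OF k]] .
    moreover have "x0 * (1 + sin x) = (1 + sin x) / (cos x - sin x) + t * (sqrt 2 * sin x * (1 + sin x) / (cos x - sin x))"
      unfolding x0_def by (simp add: divide_inverse algebra_simps)
    ultimately show "x0 * (1 + sin (pi / real k)) \<le> t * (1 - 2 * sin (pi / 8 + 5 * (pi / real k) / 8))"
      unfolding gain_def x_def by (simp add: right_diff_distrib)
  qed (use k P t x01 in auto)
  show ?thesis
    unfolding geometric_spanner_def
  proof (intro ballI)
    fix u v assume "u \<in> P" "v \<in> P"
    then obtain s where "s \<le> t * cmod (v - u)" "reach (yy_edge (2 * k) rk P) P u v s"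
      using spanner by (auto simp: conn_def)
    with reach_walk[OF this(2)] show "\<exists>xs. xs \<noteq> [] \<and> hd xs = u \<and> last xs = v \<and> set xs \<subseteq> P \<and>
        is_walk (yy_edge (2 * k) rk P) xs \<and> walk_length xs \<le> t * cmod (v - u)" by metis
  qed
qed

theorem theorem2:
  "\<exists>t :: nat \<Rightarrow> real.
     (\<lambda>k. t k - sqrt 2 / (1 - 2 * sin (pi / 8))) \<in> O(\<lambda>k. 1 / real k) \<and>
     (\<forall>k \<ge> 42. \<forall>(P :: complex set) (rk :: complex \<Rightarrow> nat).
        finite P \<longrightarrow> inj_on rk P \<longrightarrow> geometric_spanner P (yy_edge (2 * k) rk P) (t k))"
proof -
  define c where "c = sqrt 2 / (1 - 2 * sin (pi / 8))"
  \<comment> \<open>The limit of \<open>ratio\<close> is smaller than \<open>c\<close> by a factor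
    \<open>sqrt 2\<close>, so \<open>t k = c\<close> for all large \<open>k\<close> and the error
    term vanishes there; the maximum covers the remaining \<open>k\<close>.\<close>
  define t where "t k = max c (ratio (pi / real k))" for k :: nat
  have d: "0 < 1 - 2 * sin (pi / 8)" "1 - 2 * sin (pi / 8) \<le> 1"
    using sin_cos_pi8_le sin_ge_zero[of "pi / 8"] by auto
  have "1 / (1 - 2 * sin (pi / 8)) < c"
    unfolding c_def using d(1) sqrt2_bounds by (intro divide_strict_right_mono) auto
  then have "\<forall>\<^sub>F k in sequentially. ratio (pi / real k) < c" using order_tendstoD(2)[OF ratio_lim] by blast
  then have "\<forall>\<^sub>F k in sequentially. t k - c = 0" by eventually_elim (simp add: t_def)
  then have "\<forall>\<^sub>F k in sequentially. norm (t k - c) \<le> 1 * norm (1 / real k)" by eventually_elim simp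
  then have "(\<lambda>k. t k - c) \<in> O(\<lambda>k. 1 / real k)" by (rule bigoI)
  moreover have "1 \<le> c" unfolding c_def using d sqrt2_bounds by (simp add: le_divide_eq)
  ultimately show ?thesis
    unfolding c_def by (intro exI[of _ t] conjI) (auto intro!: yao_yao_spanner simp: t_def c_def[symmetric] le_max_iff_disj)
qed

end
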